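(* Let $M(\phi,\xi,\eta,g_M)$ be a Sasakian manifold, let $(N,g_N)$ be a Riemannian manifold, and let $F:M\to N$ be a slant Riemannian submersion. If $\xi$ is orthogonal to $\ker F_*$, then $F$ is anti-invariant.
   Context: An almost contact metric structure $(\phi,\xi,\eta,g)$ on $M$ consists of a $(1,1)$-tensor field $\phi$, a vector field $\xi$, a 1-form $\eta$ and a Riemannian metric $g$ with $\phi^2=-I+\eta\otimes\xi$, $\phi\xi=0$, $\eta\circ\phi=0$, $\eta(\xi)=1$, $g(\phi X,\phi Y)=g(X,Y)-\eta(X)\eta(Y)$, $\eta(X)=g(X,\xi)$. It is Sasakian if $(\nabla_X\phi)Y=g(X,Y)\xi-\eta(Y)X$ for the Levi-Civita connection $\nabla$ of $g$; then $\nabla_X\xi=-\phi X$. A Riemannian submersion $F:(M,g_M)\to(N,g_N)$ is a smooth surjective map of maximal rank such that $F_*$ preserves lengths of horizontal vectors. Vectors in $\ker F_*$ are vertical, vectors in $(\ker F_* )^\perp$ are horizontal. $F$ is slant if for every nonzero vertical vector $X$ that is not a multiple of $\xi$, the angle $\theta(X)$ between $\phi X$ and the space $\ker F_*$ is a constant $\theta$, independent of the point $p\in M$ and of $X$; $\theta$ is the slant angle. $F$ is anti-invariant if it is slant with $\theta=\pi/2$, i.e. $\phi U$ is horizontal for every vertical $U$. *)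

theory Defs
  imports "HOL-Analysis.Analysis" "HOL-Library.Function_Algebras"
begin

section \<open>Smooth maps between Euclidean spaces\<close>

text \<open>The set \<open>S\<close> is always open in what follows, so \<open>Ck_on k S f\<close> says that \<open>f\<close> is of class
  \<open>C\<^sup>k\<close> on \<open>S\<close>.\<close>

primrec Ck_on ::
  "nat \<Rightarrow> 'a::euclidean_space set \<Rightarrow> ('a \<Rightarrow> 'b::real_normed_vector) \<Rightarrow> bool" where
  "Ck_on 0 S f \<longleftrightarrow> continuous_on S f"
| "Ck_on (Suc k) S f \<longleftrightarrow>
     (\<forall>x\<in>S. f differentiable (at x)) \<and> (\<forall>v. Ck_on k S (\<lambda>x. frechet_derivative f (at x) v))"

definition smooth_on :: "'a::euclidean_space set \<Rightarrow> ('a \<Rightarrow> 'b::real_normed_vector) \<Rightarrow> bool" where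
  "smooth_on S f \<longleftrightarrow> (\<forall>k. Ck_on k S f)"


section \<open>Smooth manifolds\<close>

text \<open>A chart is a pair of a domain and a coordinate map. The coordinate map is a total function
  whose values outside the domain are irrelevant.\<close>

type_synonym ('m, 'e) chart = "'m set \<times> ('m \<Rightarrow> 'e)"

definition is_chart :: "('m::topological_space, 'e::euclidean_space) chart \<Rightarrow> bool" where
  "is_chart = (\<lambda>(U, \<kappa>). open U \<and> open (\<kappa> ` U) \<and> homeomorphism U (\<kappa> ` U) \<kappa> (inv_into U \<kappa>))"

text \<open>The points of a manifold form a whole type. A manifold is given by a smooth atlas, which
  need not be maximal; its dimension is \<open>DIM('e)\<close>.\<close>

definition smooth_manifold ::
  "('m::{t2_space, second_countable_topology}, 'e::euclidean_space) chart set \<Rightarrow> bool" where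
  "smooth_manifold A \<longleftrightarrow>
     (\<forall>c\<in>A. is_chart c) \<and> (\<Union>(U, \<kappa>)\<in>A. U) = UNIV \<and>
     (\<forall>(U, \<kappa>)\<in>A. \<forall>(V, \<mu>)\<in>A. smooth_on (\<kappa> ` (U \<inter> V)) (\<mu> \<circ> inv_into U \<kappa>))"

definition smooth_fun ::
  "('m::topological_space, 'e::euclidean_space) chart set \<Rightarrow> ('m \<Rightarrow> real) \<Rightarrow> bool" where
  "smooth_fun A f \<longleftrightarrow> (\<forall>(U, \<kappa>)\<in>A. smooth_on (\<kappa> ` U) (f \<circ> inv_into U \<kappa>))"

definition smooth_map ::
  "('m::topological_space, 'e::euclidean_space) chart set \<Rightarrow>
   ('n::topological_space, 'k::euclidean_space) chart set \<Rightarrow> ('m \<Rightarrow> 'n) \<Rightarrow> bool" where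
  "smooth_map A B F \<longleftrightarrow> continuous_on UNIV F \<and>
     (\<forall>(U, \<kappa>)\<in>A. \<forall>(V, \<mu>)\<in>B. smooth_on (\<kappa> ` (U \<inter> F -` V)) (\<mu> \<circ> F \<circ> inv_into U \<kappa>))"


section \<open>Tangent vectors and vector fields\<close>

text \<open>A tangent vector is a derivation of the algebra of smooth functions. Sums and differences of
  functions, of tangent vectors and of vector fields, and products of functions, are the pointwise
  operations of \<open>HOL-Library.Function_Algebras\<close>.\<close>

type_synonym 'm tvec = "('m \<Rightarrow> real) \<Rightarrow> real"
type_synonym 'm vfield = "'m \<Rightarrow> 'm tvec"

definition scale_fun :: "real \<Rightarrow> ('c \<Rightarrow> real) \<Rightarrow> 'c \<Rightarrow> real" (infixr "*\<^sub>f" 75) where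
  "a *\<^sub>f h = (\<lambda>x. a * h x)"

definition scale_vfield :: "('m \<Rightarrow> real) \<Rightarrow> 'm vfield \<Rightarrow> 'm vfield" (infixr "*\<^sub>v" 75) where
  "f *\<^sub>v X = (\<lambda>p. f p *\<^sub>f X p)"

text \<open>The last clause fixes the values at non-smooth functions, so that two tangent vectors are
  equal as soon as they agree on smooth functions.\<close>

definition tangent_space ::
  "('m::topological_space, 'e::euclidean_space) chart set \<Rightarrow> 'm \<Rightarrow> 'm tvec set" where
  "tangent_space A p = {v.
     (\<forall>f h. smooth_fun A f \<longrightarrow> smooth_fun A h \<longrightarrow> v (f + h) = v f + v h) \<and>
     (\<forall>a f. smooth_fun A f \<longrightarrow> v (a *\<^sub>f f) = a * v f) \<and>
     (\<forall>f h. smooth_fun A f \<longrightarrow> smooth_fun A h \<longrightarrow> v (f * h) = f p * v h + h p * v f) \<and>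
     (\<forall>f. \<not> smooth_fun A f \<longrightarrow> v f = 0)}"

definition differential ::
  "('n::topological_space, 'k::euclidean_space) chart set \<Rightarrow> ('m \<Rightarrow> 'n) \<Rightarrow> 'm tvec \<Rightarrow> 'n tvec" where
  "differential B F v = (\<lambda>h. if smooth_fun B h then v (h \<circ> F) else 0)"

definition apply_vfield :: "'m vfield \<Rightarrow> ('m \<Rightarrow> real) \<Rightarrow> 'm \<Rightarrow> real" where
  "apply_vfield X f = (\<lambda>p. X p f)"

definition smooth_vfield ::
  "('m::topological_space, 'e::euclidean_space) chart set \<Rightarrow> 'm vfield \<Rightarrow> bool" where
  "smooth_vfield A X \<longleftrightarrow> (\<forall>p. X p \<in> tangent_space A p) \<and>
     (\<forall>f. smooth_fun A f \<longrightarrow> smooth_fun A (apply_vfield X f))"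

definition lie_bracket :: "'m vfield \<Rightarrow> 'm vfield \<Rightarrow> 'm vfield" where
  "lie_bracket X Y = (\<lambda>p f. X p (apply_vfield Y f) - Y p (apply_vfield X f))"


section \<open>Tensor fields, Riemannian metrics and the Levi-Civita connection\<close>

text \<open>Tensor fields are given pointwise on the tangent spaces; their values elsewhere are
  irrelevant. Smoothness is tested on smooth vector fields.\<close>

definition one_form ::
  "('m::topological_space, 'e::euclidean_space) chart set \<Rightarrow> ('m \<Rightarrow> 'm tvec \<Rightarrow> real) \<Rightarrow> bool" where
  "one_form A \<eta> \<longleftrightarrow>
     (\<forall>p. \<forall>u\<in>tangent_space A p. \<forall>v\<in>tangent_space A p. \<eta> p (u + v) = \<eta> p u + \<eta> p v) \<and>
     (\<forall>p. \<forall>u\<in>tangent_space A p. \<forall>a. \<eta> p (a *\<^sub>f u) = a * \<eta> p u) \<and>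
     (\<forall>X. smooth_vfield A X \<longrightarrow> smooth_fun A (\<lambda>p. \<eta> p (X p)))"

definition tensor11 ::
  "('m::topological_space, 'e::euclidean_space) chart set \<Rightarrow>
   ('m \<Rightarrow> 'm tvec \<Rightarrow> 'm tvec) \<Rightarrow> bool" where
  "tensor11 A \<phi> \<longleftrightarrow>
     (\<forall>p. \<forall>u\<in>tangent_space A p. \<phi> p u \<in> tangent_space A p) \<and>
     (\<forall>p. \<forall>u\<in>tangent_space A p. \<forall>v\<in>tangent_space A p. \<phi> p (u + v) = \<phi> p u + \<phi> p v) \<and>
     (\<forall>p. \<forall>u\<in>tangent_space A p. \<forall>a. \<phi> p (a *\<^sub>f u) = a *\<^sub>f \<phi> p u) \<and>
     (\<forall>X. smooth_vfield A X \<longrightarrow> smooth_vfield A (\<lambda>p. \<phi> p (X p)))"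

definition riemannian_metric ::
  "('m::topological_space, 'e::euclidean_space) chart set \<Rightarrow>
   ('m \<Rightarrow> 'm tvec \<Rightarrow> 'm tvec \<Rightarrow> real) \<Rightarrow> bool" where
  "riemannian_metric A g \<longleftrightarrow>
     (\<forall>p. \<forall>u\<in>tangent_space A p. \<forall>v\<in>tangent_space A p. \<forall>w\<in>tangent_space A p.
        g p (u + v) w = g p u w + g p v w) \<and>
     (\<forall>p. \<forall>u\<in>tangent_space A p. \<forall>w\<in>tangent_space A p. \<forall>a. g p (a *\<^sub>f u) w = a * g p u w) \<and>
     (\<forall>p. \<forall>u\<in>tangent_space A p. \<forall>v\<in>tangent_space A p. g p u v = g p v u) \<and>
     (\<forall>p. \<forall>u\<in>tangent_space A p. u \<noteq> 0 \<longrightarrow> 0 < g p u u) \<and>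
     (\<forall>X Y. smooth_vfield A X \<longrightarrow> smooth_vfield A Y \<longrightarrow> smooth_fun A (\<lambda>p. g p (X p) (Y p)))"

definition riemannian_manifold ::
  "('m::{t2_space, second_countable_topology}, 'e::euclidean_space) chart set \<Rightarrow>
   ('m \<Rightarrow> 'm tvec \<Rightarrow> 'm tvec \<Rightarrow> real) \<Rightarrow> bool" where
  "riemannian_manifold A g \<longleftrightarrow> smooth_manifold A \<and> riemannian_metric A g"

definition affine_connection ::
  "('m::topological_space, 'e::euclidean_space) chart set \<Rightarrow>
   ('m vfield \<Rightarrow> 'm vfield \<Rightarrow> 'm vfield) \<Rightarrow> bool" where
  "affine_connection A D \<longleftrightarrow>
     (\<forall>X Y. smooth_vfield A X \<longrightarrow> smooth_vfield A Y \<longrightarrow> smooth_vfield A (D X Y)) \<and>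
     (\<forall>X Y Z. smooth_vfield A X \<longrightarrow> smooth_vfield A Y \<longrightarrow> smooth_vfield A Z \<longrightarrow>
        D (X + Y) Z = D X Z + D Y Z \<and> D X (Y + Z) = D X Y + D X Z) \<and>
     (\<forall>f X Y. smooth_fun A f \<longrightarrow> smooth_vfield A X \<longrightarrow> smooth_vfield A Y \<longrightarrow>
        D (f *\<^sub>v X) Y = f *\<^sub>v D X Y \<and> D X (f *\<^sub>v Y) = apply_vfield X f *\<^sub>v Y + f *\<^sub>v D X Y)"

definition levi_civita ::
  "('m::topological_space, 'e::euclidean_space) chart set \<Rightarrow>
   ('m \<Rightarrow> 'm tvec \<Rightarrow> 'm tvec \<Rightarrow> real) \<Rightarrow> ('m vfield \<Rightarrow> 'm vfield \<Rightarrow> 'm vfield) \<Rightarrow> bool" where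
  "levi_civita A g D \<longleftrightarrow> affine_connection A D \<and>
     (\<forall>X Y. smooth_vfield A X \<longrightarrow> smooth_vfield A Y \<longrightarrow> D X Y - D Y X = lie_bracket X Y) \<and>
     (\<forall>X Y Z. smooth_vfield A X \<longrightarrow> smooth_vfield A Y \<longrightarrow> smooth_vfield A Z \<longrightarrow>
        (\<forall>p. X p (\<lambda>q. g q (Y q) (Z q)) = g p (D X Y p) (Z p) + g p (Y p) (D X Z p)))"


section \<open>Sasakian manifolds\<close>

definition almost_contact_metric ::
  "('m::topological_space, 'e::euclidean_space) chart set \<Rightarrow> ('m \<Rightarrow> 'm tvec \<Rightarrow> 'm tvec) \<Rightarrow>
   'm vfield \<Rightarrow> ('m \<Rightarrow> 'm tvec \<Rightarrow> real) \<Rightarrow> ('m \<Rightarrow> 'm tvec \<Rightarrow> 'm tvec \<Rightarrow> real) \<Rightarrow> bool" where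
  "almost_contact_metric A \<phi> \<xi> \<eta> g \<longleftrightarrow>
     tensor11 A \<phi> \<and> smooth_vfield A \<xi> \<and> one_form A \<eta> \<and> riemannian_metric A g \<and>
     (\<forall>p. \<phi> p (\<xi> p) = 0 \<and> \<eta> p (\<xi> p) = 1 \<and>
       (\<forall>u\<in>tangent_space A p.
          \<phi> p (\<phi> p u) = - u + \<eta> p u *\<^sub>f \<xi> p \<and> \<eta> p (\<phi> p u) = 0 \<and> \<eta> p u = g p u (\<xi> p) \<and>
          (\<forall>v\<in>tangent_space A p. g p (\<phi> p u) (\<phi> p v) = g p u v - \<eta> p u * \<eta> p v)))"

text \<open>The Levi-Civita connection exists and is unique as an operation on smooth vector fields, but
  as a function on all of \<open>'m vfield\<close> it is not, whence the existential quantifier. The left-hand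
  side of the last equation is \<open>(D\<^sub>X \<phi>) Y\<close>.\<close>

definition sasakian_manifold ::
  "('m::{t2_space, second_countable_topology}, 'e::euclidean_space) chart set \<Rightarrow>
   ('m \<Rightarrow> 'm tvec \<Rightarrow> 'm tvec) \<Rightarrow> 'm vfield \<Rightarrow> ('m \<Rightarrow> 'm tvec \<Rightarrow> real) \<Rightarrow>
   ('m \<Rightarrow> 'm tvec \<Rightarrow> 'm tvec \<Rightarrow> real) \<Rightarrow> bool" where
  "sasakian_manifold A \<phi> \<xi> \<eta> g \<longleftrightarrow> smooth_manifold A \<and> almost_contact_metric A \<phi> \<xi> \<eta> g \<and>
     (\<exists>D. levi_civita A g D \<and>
       (\<forall>X Y. smooth_vfield A X \<longrightarrow> smooth_vfield A Y \<longrightarrow>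
         (\<forall>p. D X (\<lambda>q. \<phi> q (Y q)) p - \<phi> p (D X Y p) =
              g p (X p) (Y p) *\<^sub>f \<xi> p - \<eta> p (Y p) *\<^sub>f X p)))"


section \<open>Slant Riemannian submersions\<close>

definition vertical ::
  "('m::topological_space, 'e::euclidean_space) chart set \<Rightarrow>
   ('n::topological_space, 'k::euclidean_space) chart set \<Rightarrow> ('m \<Rightarrow> 'n) \<Rightarrow> 'm \<Rightarrow> 'm tvec set" where
  "vertical A B F p = {v \<in> tangent_space A p. differential B F v = 0}"

definition horizontal ::
  "('m::topological_space, 'e::euclidean_space) chart set \<Rightarrow>
   ('n::topological_space, 'k::euclidean_space) chart set \<Rightarrow>
   ('m \<Rightarrow> 'm tvec \<Rightarrow> 'm tvec \<Rightarrow> real) \<Rightarrow> ('m \<Rightarrow> 'n) \<Rightarrow> 'm \<Rightarrow> 'm tvec set" where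
  "horizontal A B g F p = {w \<in> tangent_space A p. \<forall>v\<in>vertical A B F p. g p w v = 0}"

definition riemannian_submersion ::
  "('m::topological_space, 'e::euclidean_space) chart set \<Rightarrow>
   ('m \<Rightarrow> 'm tvec \<Rightarrow> 'm tvec \<Rightarrow> real) \<Rightarrow>
   ('n::topological_space, 'k::euclidean_space) chart set \<Rightarrow>
   ('n \<Rightarrow> 'n tvec \<Rightarrow> 'n tvec \<Rightarrow> real) \<Rightarrow> ('m \<Rightarrow> 'n) \<Rightarrow> bool" where
  "riemannian_submersion A g B g' F \<longleftrightarrow> smooth_map A B F \<and> surj F \<and>
     (\<forall>p. differential B F ` tangent_space A p = tangent_space B (F p)) \<and>
     (\<forall>p. \<forall>w\<in>horizontal A B g F p.
        g' (F p) (differential B F w) (differential B F w) = g p w w)"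

text \<open>The angle between a vector \<open>w\<close> and a subspace \<open>V\<close>, with respect to an inner product \<open>b\<close>, is the
  angle between \<open>w\<close> and its orthogonal projection to \<open>V\<close>; it lies between \<open>0\<close> and \<open>pi / 2\<close> and equals
  \<open>pi / 2\<close> when the projection vanishes.\<close>

definition orth_proj ::
  "('m tvec \<Rightarrow> 'm tvec \<Rightarrow> real) \<Rightarrow> 'm tvec set \<Rightarrow> 'm tvec \<Rightarrow> 'm tvec" where
  "orth_proj b V w = (THE v. v \<in> V \<and> (\<forall>u\<in>V. b (w - v) u = 0))"

definition angle_to_subspace ::
  "('m tvec \<Rightarrow> 'm tvec \<Rightarrow> real) \<Rightarrow> 'm tvec \<Rightarrow> 'm tvec set \<Rightarrow> real" where
  "angle_to_subspace b w V =
     arccos (sqrt (b (orth_proj b V w) (orth_proj b V w)) / sqrt (b w w))"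

definition slant_submersion_with_angle ::
  "real \<Rightarrow> ('m::topological_space, 'e::euclidean_space) chart set \<Rightarrow>
   ('m \<Rightarrow> 'm tvec \<Rightarrow> 'm tvec) \<Rightarrow> 'm vfield \<Rightarrow> ('m \<Rightarrow> 'm tvec \<Rightarrow> 'm tvec \<Rightarrow> real) \<Rightarrow>
   ('n::topological_space, 'k::euclidean_space) chart set \<Rightarrow>
   ('n \<Rightarrow> 'n tvec \<Rightarrow> 'n tvec \<Rightarrow> real) \<Rightarrow> ('m \<Rightarrow> 'n) \<Rightarrow> bool" where
  "slant_submersion_with_angle \<theta> A \<phi> \<xi> g B g' F \<longleftrightarrow> riemannian_submersion A g B g' F \<and>
     (\<forall>p. \<forall>u\<in>vertical A B F p. u \<noteq> 0 \<and> (\<forall>a. u \<noteq> a *\<^sub>f \<xi> p) \<longrightarrow>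
        angle_to_subspace (g p) (\<phi> p u) (vertical A B F p) = \<theta>)"

definition slant_submersion ::
  "('m::topological_space, 'e::euclidean_space) chart set \<Rightarrow>
   ('m \<Rightarrow> 'm tvec \<Rightarrow> 'm tvec) \<Rightarrow> 'm vfield \<Rightarrow> ('m \<Rightarrow> 'm tvec \<Rightarrow> 'm tvec \<Rightarrow> real) \<Rightarrow>
   ('n::topological_space, 'k::euclidean_space) chart set \<Rightarrow>
   ('n \<Rightarrow> 'n tvec \<Rightarrow> 'n tvec \<Rightarrow> real) \<Rightarrow> ('m \<Rightarrow> 'n) \<Rightarrow> bool" where
  "slant_submersion A \<phi> \<xi> g B g' F \<longleftrightarrow> (\<exists>\<theta>. slant_submersion_with_angle \<theta> A \<phi> \<xi> g B g' F)"

definition anti_invariant_submersion ::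
  "('m::topological_space, 'e::euclidean_space) chart set \<Rightarrow>
   ('m \<Rightarrow> 'm tvec \<Rightarrow> 'm tvec) \<Rightarrow> 'm vfield \<Rightarrow> ('m \<Rightarrow> 'm tvec \<Rightarrow> 'm tvec \<Rightarrow> real) \<Rightarrow>
   ('n::topological_space, 'k::euclidean_space) chart set \<Rightarrow>
   ('n \<Rightarrow> 'n tvec \<Rightarrow> 'n tvec \<Rightarrow> real) \<Rightarrow> ('m \<Rightarrow> 'n) \<Rightarrow> bool" where
  "anti_invariant_submersion A \<phi> \<xi> g B g' F \<longleftrightarrow>
     slant_submersion_with_angle (pi / 2) A \<phi> \<xi> g B g' F"

end

theory Submission
  imports Defs "HOL-Real_Asymp.Real_Asymp"
begin

text \<open>Let \<open>X\<close> and \<open>Y\<close> be vertical vector fields. Since \<open>\<xi>\<close> is orthogonal to both,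
  differentiating \<open>g(Y, \<xi>) = 0\<close> along \<open>X\<close> and using \<open>D\<^sub>X \<xi> = - \<phi> X\<close> gives
  \<open>g(D\<^sub>X Y, \<xi>) = g(\<phi> X, Y)\<close>. Antisymmetrising, \<open>g([X, Y], \<xi>) = 2 g(\<phi> X, Y)\<close>, and the left-hand
  side vanishes because \<open>[X, Y]\<close> is vertical. As every vertical vector extends to a global vertical
  vector field, \<open>\<phi>\<close> maps vertical vectors to horizontal ones.

  The extension needs that tangent vectors, which are abstract derivations, are combinations
  of coordinate derivatives; this is Hadamard's lemma together with bump functions.\<close>

section \<open>Calculus of smooth functions\<close>

text \<open>The connection acts on fields over all of \<open>M\<close>, and verticality of the
  bracket at \<open>p\<close> is deduced from verticality of both fields at every point, so
  \<open>u\<close> and \<open>v\<close> need global extensions that stay vertical. Freezing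
  coefficients in a frame of \<open>M\<close> loses verticality. Instead, coordinates
  \<open>y_b\<close> of \<open>N\<close> are pulled back: surjectivity of the differential yields
  vectors at \<open>p\<close> dual to the functions \<open>y_b \<circ> F\<close>, whose extensions
  correct an arbitrary extension of \<open>u\<close> until it annihilates every
  \<open>y_b \<circ> F\<close>. A cutoff pulled back from \<open>N\<close> then removes the region
  where the \<open>y_b\<close> no longer determine tangent vectors. Derivations act on global
  functions only, so every local expansion has to be multiplied by a cutoff before a derivation is
  applied to it. The formula for \<open>D \<xi>\<close> comes from \<open>Y = \<xi>\<close> in the
  Sasakian identity, where \<phi> \<xi> = 0. The antisymmetrised terms add up instead of cancelling
  because \<open>g(\<phi> X, Y)\<close> is skew.\<close>

lemma Ck_on_Suc_has_derivative:
  "Ck_on (Suc k) S f \<Longrightarrow> x \<in> S \<Longrightarrow> (f has_derivative frechet_derivative f (at x)) (at x)"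
  by (simp add: frechet_derivative_works[symmetric])

text \<open>Openness lets values off \<open>S\<close> be ignored even for derivatives. This matters
  for functions read in a chart, which are arbitrary outside its image.\<close>

lemma Ck_on_cong:
  assumes "open S" "\<And>x. x \<in> S \<Longrightarrow> f x = g x" "Ck_on k S f"
  shows "Ck_on k S g"
  using assms(2,3)
proof (induction k arbitrary: f g)
  case 0
  then show ?case by (simp cong: continuous_on_cong)
next
  case (Suc k)
  have D: "(g has_derivative frechet_derivative f (at x)) (at x)" if "x \<in> S" for x
    using Ck_on_Suc_has_derivative[OF Suc.prems(2) that] assms(1) that Suc.prems(1)
    by (rule has_derivative_transform_within_open)
  then have eq: "frechet_derivative f (at x) = frechet_derivative g (at x)" if "x \<in> S" for x
    using that frechet_derivative_at by blast
  have "Ck_on k S (\<lambda>x. frechet_derivative g (at x) v)" for v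
    by (rule Suc.IH[of "\<lambda>x. frechet_derivative f (at x) v"]) (use Suc.prems eq in auto)
  then show ?case
    using D by (auto simp: differentiable_def)
qed

text \<open>By uniqueness of the derivative, any explicit formula \<open>D\<close> may replace the
  term \<open>frechet_derivative\<close>; all closure properties below are inductions through this
  rule.\<close>

lemma Ck_on_SucI:
  assumes "open S" "\<And>x. x \<in> S \<Longrightarrow> (f has_derivative D x) (at x)"
    "\<And>v. Ck_on k S (\<lambda>x. D x v)"
  shows "Ck_on (Suc k) S f"
proof -
  have "D x = frechet_derivative f (at x)" if "x \<in> S" for x
    using assms(2)[OF that] by (rule frechet_derivative_at)
  then have "Ck_on k S (\<lambda>x. frechet_derivative f (at x) v)" for v
    by (intro Ck_on_cong[OF assms(1) _ assms(3)[of v]]) auto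
  then show ?thesis
    using assms(2) by (auto simp: differentiable_def)
qed

lemma Ck_on_SucD: "Ck_on (Suc k) S f \<Longrightarrow> Ck_on k S f"
proof (induction k arbitrary: f)
  case 0
  then show ?case
    by (auto intro!: continuous_at_imp_continuous_on differentiable_imp_continuous_within)
next
  case (Suc k)
  then show ?case using Ck_on.simps(2) by blast
qed

lemma Ck_on_imp_continuous_on: "Ck_on k S f \<Longrightarrow> continuous_on S f"
  by (induction k) (auto dest: Ck_on_SucD simp del: Ck_on.simps(2))

lemma Ck_on_subset: "Ck_on k S f \<Longrightarrow> T \<subseteq> S \<Longrightarrow> Ck_on k T f"
  by (induction k arbitrary: f) (auto intro: continuous_on_subset)

lemma Ck_on_Union: "(\<And>T. T \<in> \<T> \<Longrightarrow> open T \<and> Ck_on k T f) \<Longrightarrow> Ck_on k (\<Union>\<T>) f"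
  by (induction k arbitrary: f) (auto intro!: continuous_on_open_Union)

lemma Ck_on_const: "Ck_on k S (\<lambda>x. c)"
proof (induction k arbitrary: c)
  case (Suc k)
  have "frechet_derivative (\<lambda>x. c) (at x) = (\<lambda>_. 0)" for x :: 'a
    by (metis frechet_derivative_at has_derivative_const)
  with Suc show ?case by simp
qed simp

lemma Ck_on_bounded_linear:
  assumes "bounded_linear L"
  shows "Ck_on k S L"
proof (cases k)
  case 0
  then show ?thesis using assms by (simp add: linear_continuous_on)
next
  case (Suc j)
  have "Ck_on (Suc j) UNIV L"
    by (rule Ck_on_SucI[where D="\<lambda>_. L"])
      (auto intro: bounded_linear_imp_has_derivative assms Ck_on_const)
  then show ?thesis using Suc Ck_on_subset by blast
qed

lemma Ck_on_add:
  assumes "open S" "Ck_on k S f" "Ck_on k S g"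
  shows "Ck_on k S (\<lambda>x. f x + g x)"
  using assms(2,3)
proof (induction k arbitrary: f g)
  case 0
  then show ?case by (simp add: continuous_on_add)
next
  case (Suc k)
  show ?case
  proof (rule Ck_on_SucI[OF assms(1)])
    show "((\<lambda>x. f x + g x) has_derivative
        (\<lambda>v. frechet_derivative f (at x) v + frechet_derivative g (at x) v)) (at x)" if "x \<in> S" for x
      using Suc.prems that by (intro has_derivative_add Ck_on_Suc_has_derivative)
    show "Ck_on k S (\<lambda>x. frechet_derivative f (at x) v + frechet_derivative g (at x) v)" for v
      by (intro Suc.IH) (use Suc.prems in auto)
  qed
qed

lemma Ck_on_sum:
  assumes "open S" "\<And>i. i \<in> I \<Longrightarrow> Ck_on k S (f i)"
  shows "Ck_on k S (\<lambda>x. \<Sum>i\<in>I. f i x)"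
  using assms(2) by (induction I rule: infinite_finite_induct) (auto intro: Ck_on_const Ck_on_add[OF assms(1)])

lemma Ck_on_mult:
  fixes f g :: "'a::euclidean_space \<Rightarrow> real"
  assumes "open S" "Ck_on k S f" "Ck_on k S g"
  shows "Ck_on k S (\<lambda>x. f x * g x)"
  using assms(2,3)
proof (induction k arbitrary: f g)
  case 0
  then show ?case by (simp add: continuous_on_mult)
next
  case (Suc k)
  show ?case
  proof (rule Ck_on_SucI[OF assms(1)])
    show "((\<lambda>x. f x * g x) has_derivative
        (\<lambda>v. f x * frechet_derivative g (at x) v + frechet_derivative f (at x) v * g x)) (at x)"
      if "x \<in> S" for x
      using Suc.prems that by (intro has_derivative_mult Ck_on_Suc_has_derivative)
    \<comment> \<open>The product rule keeps undifferentiated factors, which are lowered from class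
      \<open>Suc k\<close> to \<open>k\<close> before the induction hypothesis applies.\<close>
    show "Ck_on k S (\<lambda>x. f x * frechet_derivative g (at x) v + frechet_derivative f (at x) v * g x)" for v
      using Suc.prems Ck_on_SucD[OF Suc.prems(1)] Ck_on_SucD[OF Suc.prems(2)]
      by (intro Ck_on_add assms(1) Suc.IH) auto
  qed
qed

lemma Ck_on_bounded_linear_compose:
  assumes "open S" "bounded_linear L" "Ck_on k S f"
  shows "Ck_on k S (\<lambda>x. L (f x))"
  using assms(3)
proof (induction k arbitrary: f)
  case 0
  then show ?case using assms(2) by (simp add: bounded_linear.continuous_on)
next
  case (Suc k)
  show ?case
  proof (rule Ck_on_SucI[OF assms(1)])
    show "((\<lambda>x. L (f x)) has_derivative (\<lambda>v. L (frechet_derivative f (at x) v))) (at x)"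
      if "x \<in> S" for x
      using Suc.prems that
      by (intro bounded_linear.has_derivative[OF assms(2)] Ck_on_Suc_has_derivative)
    show "Ck_on k S (\<lambda>x. L (frechet_derivative f (at x) v))" for v
      by (intro Suc.IH) (use Suc.prems in auto)
  qed
qed

lemma Ck_on_compose:
  fixes f :: "'a::euclidean_space \<Rightarrow> 'b::euclidean_space" and g :: "'b \<Rightarrow> real"
  assumes "open S" "open T" "f ` S \<subseteq> T" "Ck_on k S f" "Ck_on k T g"
  shows "Ck_on k S (\<lambda>x. g (f x))"
  using assms(4,5)
proof (induction k arbitrary: g)
  case 0
  then show ?case using assms(3) by (simp add: continuous_on_compose2)
next
  case (Suc k)
  let ?D = "\<lambda>x v. frechet_derivative g (at (f x)) (frechet_derivative f (at x) v)"
  show ?case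
  proof (rule Ck_on_SucI[OF assms(1)])
    show "((\<lambda>x. g (f x)) has_derivative ?D x) (at x)" if "x \<in> S" for x
      using assms(3) that
      by (intro has_derivative_compose[of f _ x UNIV g]
          Ck_on_Suc_has_derivative[OF Suc.prems(1)] Ck_on_Suc_has_derivative[OF Suc.prems(2)]) auto
    \<comment> \<open>In the chain rule the direction fed to the derivative of \<open>g\<close>
      itself depends on \<open>x\<close>. Expanding it in the basis leaves sums of products of real
      functions, with the induction hypothesis used for the partial derivatives of
      \<open>g\<close>.\<close>
    show "Ck_on k S (\<lambda>x. ?D x v)" for v
    proof (rule Ck_on_cong[OF assms(1)])
      show "(\<Sum>b\<in>Basis. (frechet_derivative f (at x) v \<bullet> b) * frechet_derivative g (at (f x)) b)
          = ?D x v" if "x \<in> S" for x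
      proof -
        have "f x \<in> T" using that assms(3) by auto
        then have "linear (frechet_derivative g (at (f x)))"
          using Ck_on_Suc_has_derivative[OF Suc.prems(2)] has_derivative_linear by blast
        then show ?thesis
          by (subst (2) euclidean_representation[symmetric, of "frechet_derivative f (at x) v"])
            (simp add: linear_sum linear_cmul)
      qed
      show "Ck_on k S (\<lambda>x. \<Sum>b\<in>Basis. (frechet_derivative f (at x) v \<bullet> b) * frechet_derivative g (at (f x)) b)"
        using Suc.prems Ck_on_SucD[OF Suc.prems(1)]
        by (intro Ck_on_sum Ck_on_mult assms(1) Suc.IH
            Ck_on_bounded_linear_compose[OF assms(1) bounded_linear_inner_left]) auto
    qed
  qed
qed

text \<open>The derivative of \<open>1 / f\<close> contains \<open>1 / f\<close> again, but only in
  class \<open>k\<close>, so the induction closes on the same function.\<close>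

lemma Ck_on_inverse:
  fixes f :: "'a::euclidean_space \<Rightarrow> real"
  assumes "open S" "Ck_on k S f" "\<And>x. x \<in> S \<Longrightarrow> f x \<noteq> 0"
  shows "Ck_on k S (\<lambda>x. inverse (f x))"
  using assms(2)
proof (induction k)
  case 0
  then show ?case using assms(3) by (simp add: continuous_on_inverse)
next
  case (Suc k)
  let ?D = "\<lambda>x v. - (inverse (f x) * frechet_derivative f (at x) v * inverse (f x))"
  show ?case
  proof (rule Ck_on_SucI[OF assms(1)])
    show "((\<lambda>x. inverse (f x)) has_derivative ?D x) (at x)" if "x \<in> S" for x
      using that assms(3) Suc.prems
      by (intro Deriv.has_derivative_inverse Ck_on_Suc_has_derivative) auto
    show "Ck_on k S (\<lambda>x. ?D x v)" for v
      using Suc.prems Ck_on_SucD[OF Suc.prems]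
      by (intro Ck_on_bounded_linear_compose[OF assms(1) bounded_linear_minus[OF bounded_linear_ident]]
          Ck_on_mult assms(1) Suc.IH) auto
  qed
qed

lemma smooth_onI: "(\<And>k. Ck_on k S f) \<Longrightarrow> smooth_on S f"
  by (simp add: smooth_on_def)

lemma smooth_onD: "smooth_on S f \<Longrightarrow> Ck_on k S f"
  by (simp add: smooth_on_def)

lemma smooth_on_imp_continuous_on: "smooth_on S f \<Longrightarrow> continuous_on S f"
  using Ck_on_imp_continuous_on smooth_onD by blast

lemma smooth_on_has_derivative:
  "smooth_on S f \<Longrightarrow> x \<in> S \<Longrightarrow> (f has_derivative frechet_derivative f (at x)) (at x)"
  using Ck_on_Suc_has_derivative smooth_onD by blast

lemma smooth_on_frechet_derivative:
  "smooth_on S f \<Longrightarrow> smooth_on S (\<lambda>x. frechet_derivative f (at x) v)"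
  unfolding smooth_on_def using Ck_on.simps(2) by blast

lemma smooth_on_cong:
  "open S \<Longrightarrow> (\<And>x. x \<in> S \<Longrightarrow> f x = g x) \<Longrightarrow> smooth_on S f \<Longrightarrow> smooth_on S g"
  unfolding smooth_on_def using Ck_on_cong by blast

lemma smooth_on_subset: "smooth_on S f \<Longrightarrow> T \<subseteq> S \<Longrightarrow> smooth_on T f"
  unfolding smooth_on_def using Ck_on_subset by blast

lemma smooth_on_local:
  assumes "\<And>x. x \<in> S \<Longrightarrow> \<exists>T. open T \<and> x \<in> T \<and> smooth_on T f"
  shows "smooth_on S f"
proof (rule smooth_onI)
  fix k
  have "Ck_on k (\<Union>{T. open T \<and> smooth_on T f}) f"
    by (rule Ck_on_Union) (auto dest: smooth_onD)
  then show "Ck_on k S f"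
    by (rule Ck_on_subset) (use assms in blast)
qed

lemma smooth_on_const: "smooth_on S (\<lambda>x. c)"
  by (simp add: Ck_on_const smooth_onI)

lemma smooth_on_bounded_linear: "bounded_linear L \<Longrightarrow> smooth_on S L"
  by (simp add: Ck_on_bounded_linear smooth_onI)

lemma smooth_on_add:
  "open S \<Longrightarrow> smooth_on S f \<Longrightarrow> smooth_on S g \<Longrightarrow> smooth_on S (\<lambda>x. f x + g x)"
  by (simp add: Ck_on_add smooth_on_def)

lemma smooth_on_mult:
  "open S \<Longrightarrow> smooth_on S f \<Longrightarrow> smooth_on S g \<Longrightarrow> smooth_on S (\<lambda>x. f x * g x :: real)"
  by (simp add: Ck_on_mult smooth_on_def)

lemma smooth_on_sum:
  "open S \<Longrightarrow> (\<And>i. i \<in> I \<Longrightarrow> smooth_on S (f i)) \<Longrightarrow> smooth_on S (\<lambda>x. \<Sum>i\<in>I. f i x)"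
  by (simp add: Ck_on_sum smooth_on_def)

lemma smooth_on_diff:
  fixes f g :: "'a::euclidean_space \<Rightarrow> real"
  assumes "open S" "smooth_on S f" "smooth_on S g"
  shows "smooth_on S (\<lambda>x. f x - g x)"
  using smooth_on_add[OF assms(1,2) smooth_on_mult[OF assms(1) smooth_on_const[of S "-1"] assms(3)]]
  by simp

lemma smooth_on_compose:
  fixes f :: "'a::euclidean_space \<Rightarrow> 'b::euclidean_space" and g :: "'b \<Rightarrow> real"
  shows "open S \<Longrightarrow> open T \<Longrightarrow> f ` S \<subseteq> T \<Longrightarrow> smooth_on S f \<Longrightarrow> smooth_on T g \<Longrightarrow>
    smooth_on S (\<lambda>x. g (f x))"
  unfolding smooth_on_def by (rule allI, rule Ck_on_compose) auto

lemma smooth_on_divide: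
  fixes f g :: "'a::euclidean_space \<Rightarrow> real"
  shows "open S \<Longrightarrow> smooth_on S f \<Longrightarrow> smooth_on S g \<Longrightarrow> (\<And>x. x \<in> S \<Longrightarrow> g x \<noteq> 0) \<Longrightarrow>
    smooth_on S (\<lambda>x. f x / g x)"
  by (simp add: divide_inverse smooth_on_def Ck_on_mult Ck_on_inverse)

text \<open>The powers of \<open>1 / x\<close> make the family closed under differentiation.\<close>

definition flat_exp :: "nat \<Rightarrow> real \<Rightarrow> real" where
  "flat_exp n x = (if x \<le> 0 then 0 else inverse x ^ n * exp (- inverse x))"

lemma flat_exp_tendsto_0: "(flat_exp n \<longlongrightarrow> 0) (at 0)"
proof -
  have "((\<lambda>x. inverse x ^ n * exp (- inverse x)) \<longlongrightarrow> 0) (at_right (0::real))"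
    by real_asymp
  then have "(flat_exp n \<longlongrightarrow> 0) (at_right 0)"
    by (rule Lim_transform_eventually)
      (auto simp: eventually_at_filter flat_exp_def)
  moreover have "(flat_exp n \<longlongrightarrow> 0) (at_left 0)"
    by (rule Lim_transform_eventually[OF tendsto_const])
      (auto simp: eventually_at_filter flat_exp_def)
  ultimately show ?thesis
    by (simp add: filterlim_split_at)
qed

text \<open>For positive \<open>x\<close>, the exponential contributes the factor
  \<open>1 / x^2\<close>, hence the index \<open>n + 2\<close>, and the power contributes
  \<open>- n / x\<close>. For \<open>x \<le> 0\<close> the formula evaluates to 0.\<close>

lemma has_derivative_flat_exp:
  "(flat_exp n has_derivative (\<lambda>v. v * (flat_exp (n + 2) x - real n * flat_exp (n + 1) x))) (at x)"
proof -
  consider "x < 0" | "x = 0" | "x > 0" by linarith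
  then have "(flat_exp n has_real_derivative flat_exp (n + 2) x - real n * flat_exp (n + 1) x) (at x)"
  proof cases
    case 1
    have "((\<lambda>x. 0) has_real_derivative 0) (at x)" by simp
    then have "(flat_exp n has_real_derivative 0) (at x)"
      by (rule has_field_derivative_transform_within_open[where S="{..<0}"])
        (use 1 in \<open>auto simp: flat_exp_def\<close>)
    then show ?thesis using 1 by (simp add: flat_exp_def)
  next
    case 2
    \<comment> \<open>The difference quotient at 0 is the next member of the family,
      \<open>flat_exp (Suc n)\<close>, whose limit is already known.\<close>
    have "((\<lambda>h. flat_exp n h / h) \<longlongrightarrow> 0) (at 0)"
      by (rule Lim_transform_eventually[OF flat_exp_tendsto_0[of "Suc n"]])
        (auto simp: eventually_at_filter flat_exp_def field_simps)
    then show ?thesis using 2 by (simp add: DERIV_def) (simp add: flat_exp_def)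
  next
    case 3
    have "((\<lambda>x. inverse x ^ n * exp (- inverse x)) has_real_derivative
        flat_exp (n + 2) x - real n * flat_exp (n + 1) x) (at x)"
    proof -
      have i: "(inverse has_real_derivative - (inverse x)\<^sup>2) (at x)"
        using 3 DERIV_inverse[of x UNIV] by (simp add: numeral_2_eq_2)
      have p: "((\<lambda>x. inverse x ^ n) has_real_derivative - real n * inverse x ^ (n + 1)) (at x)"
        using DERIV_power[OF i, of n] by (cases n) (simp_all add: power2_eq_square algebra_simps)
      have e: "((\<lambda>x. exp (- inverse x)) has_real_derivative exp (- inverse x) * (inverse x)\<^sup>2) (at x)"
        using DERIV_fun_exp[OF DERIV_minus[OF i]] by simp
      show ?thesis
        using DERIV_mult[OF p e] 3
        by (simp add: flat_exp_def power2_eq_square algebra_simps)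
    qed
    then show ?thesis
      by (rule has_field_derivative_transform_within_open[where S="{0<..}"])
        (use 3 in \<open>auto simp: flat_exp_def\<close>)
  qed
  then show ?thesis
    by (simp add: has_field_derivative_def mult_commute_abs)
qed

lemma smooth_on_flat_exp: "smooth_on UNIV (flat_exp n)"
proof (rule smooth_onI)
  show "Ck_on k UNIV (flat_exp n)" for k
  proof (induction k arbitrary: n)
    case 0
    show ?case
      using has_derivative_continuous[OF has_derivative_flat_exp]
      by (auto intro: continuous_at_imp_continuous_on)
  next
    case (Suc k)
    show ?case
    proof (rule Ck_on_SucI[OF open_UNIV has_derivative_flat_exp])
      fix v
      have "Ck_on k UNIV (\<lambda>x. v * (flat_exp (n + 2) x + (- real n) * flat_exp (n + 1) x))"
        by (intro Ck_on_mult Ck_on_add Ck_on_const Suc open_UNIV)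
      then show "Ck_on k UNIV (\<lambda>x. v * (flat_exp (n + 2) x - real n * flat_exp (n + 1) x))"
        by simp
    qed
  qed
qed

section \<open>Cutoff functions supported in balls\<close>

lemma smooth_on_norm_diff_squared:
  fixes c :: "'a::euclidean_space"
  shows "smooth_on UNIV (\<lambda>x. (norm (x - c))\<^sup>2)"
proof -
  have 1: "smooth_on UNIV (\<lambda>x. x \<bullet> b - c \<bullet> b)" for b
    by (intro smooth_on_diff smooth_on_const smooth_on_bounded_linear bounded_linear_inner_left) simp
  have "smooth_on UNIV (\<lambda>x. \<Sum>b\<in>Basis. (x \<bullet> b - c \<bullet> b) * (x \<bullet> b - c \<bullet> b))"
    by (intro smooth_on_sum smooth_on_mult 1 open_UNIV)
  moreover have "(\<Sum>b\<in>Basis. (x \<bullet> b - c \<bullet> b) * (x \<bullet> b - c \<bullet> b)) = (norm (x - c))\<^sup>2" for x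
    unfolding power2_norm_eq_inner euclidean_inner[of "x - c" "x - c"] by (simp add: inner_diff_left)
  ultimately show ?thesis by simp
qed

text \<open>The quotient \<open>u / (u + w)\<close> works: \<open>u\<close> vanishes outside the
  ball of radius \<open>s\<close>, \<open>w\<close> vanishes inside the ball of radius
  \<open>r\<close>, and \<open>r < s\<close> keeps both from vanishing together. Squared distances
  are used because the norm is not smooth at the centre.\<close>

lemma obtain_bump:
  fixes c :: "'a::euclidean_space"
  assumes "0 < r" "r < s"
  obtains \<beta> :: "'a \<Rightarrow> real" where "smooth_on UNIV \<beta>"
    "\<And>x. x \<in> cball c r \<Longrightarrow> \<beta> x = 1" "\<And>x. x \<notin> cball c s \<Longrightarrow> \<beta> x = 0"
proof -
  let ?n = "\<lambda>x. (norm (x - c))\<^sup>2"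
  let ?u = "\<lambda>x. flat_exp 0 (s\<^sup>2 - ?n x)" and ?w = "\<lambda>x. flat_exp 0 (?n x - r\<^sup>2)"
  let ?\<beta> = "\<lambda>x. ?u x / (?u x + ?w x)"
  have rs: "r\<^sup>2 < s\<^sup>2" using assms by (simp add: power_strict_mono)
  have nn: "?u x \<ge> 0" "?w x \<ge> 0" for x by (auto simp: flat_exp_def)
  have "?u x > 0 \<or> ?w x > 0" for x using rs by (auto simp: flat_exp_def)
  then have pos: "?u x + ?w x \<noteq> 0" for x using nn[of x] by (metis add_nonneg_eq_0_iff less_irrefl)
  have u: "smooth_on UNIV ?u"
    by (rule smooth_on_compose[OF _ _ _ _ smooth_on_flat_exp])
      (auto intro!: smooth_on_diff smooth_on_const smooth_on_norm_diff_squared)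
  have w: "smooth_on UNIV ?w"
    by (rule smooth_on_compose[OF _ _ _ _ smooth_on_flat_exp])
      (auto intro!: smooth_on_diff smooth_on_const smooth_on_norm_diff_squared)
  show ?thesis
  proof
    show "smooth_on UNIV ?\<beta>"
      by (intro smooth_on_divide smooth_on_add u w pos open_UNIV)
    show "?\<beta> x = 1" if "x \<in> cball c r" for x
    proof -
      have "?n x \<le> r\<^sup>2"
        using that assms by (auto simp: dist_norm norm_minus_commute intro!: power_mono)
      then have "?w x = 0" by (simp add: flat_exp_def)
      then show ?thesis using pos[of x] by simp
    qed
    show "?\<beta> x = 0" if "x \<notin> cball c s" for x
    proof -
      have "s\<^sup>2 \<le> ?n x"
        using that assms by (auto simp: dist_norm norm_minus_commute intro!: power_mono)
      then show ?thesis by (simp add: flat_exp_def)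
    qed
  qed
qed

text \<open>The open sets \<open>S\<close> and \<open>- K\<close> cover the space. On the second the
  product is 0, whatever values \<open>f\<close> has off \<open>S\<close>.\<close>

lemma smooth_on_mult_cutoff:
  fixes \<beta> f :: "'a::euclidean_space \<Rightarrow> real"
  assumes "smooth_on UNIV \<beta>" "\<And>x. x \<notin> K \<Longrightarrow> \<beta> x = 0" "closed K" "K \<subseteq> S" "open S" "smooth_on S f"
  shows "smooth_on UNIV (\<lambda>x. \<beta> x * f x)"
proof (rule smooth_on_local)
  fix x :: 'a
  show "\<exists>T. open T \<and> x \<in> T \<and> smooth_on T (\<lambda>x. \<beta> x * f x)"
  proof (cases "x \<in> S")
    case True
    then show ?thesis
      using assms by (intro exI[of _ S] conjI smooth_on_mult) (auto intro: smooth_on_subset)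
  next
    case False
    have "smooth_on (- K) (\<lambda>x. \<beta> x * f x)"
      by (rule smooth_on_cong[OF _ _ smooth_on_const[of _ 0]]) (use assms in auto)
    then show ?thesis
      using False assms by (intro exI[of _ "- K"]) auto
  qed
qed

section \<open>Hadamard's lemma\<close>

lemma ball_ray_mem:
  fixes x c :: "'a::euclidean_space"
  assumes "x \<in> ball c r" "t \<in> {0..1}"
  shows "c + t *\<^sub>R (x - c) \<in> ball c r"
proof -
  have "norm (t *\<^sub>R (x - c)) \<le> 1 * norm (x - c)"
    unfolding norm_scaleR using assms(2) by (intro mult_right_mono) auto
  then show ?thesis using assms(1) by (simp add: dist_norm norm_minus_commute)
qed

lemma continuous_on_ray:
  fixes h :: "'a::euclidean_space \<Rightarrow> real"
  assumes "continuous_on (ball c r) h"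
  shows "continuous_on (ball c r \<times> {0..1}) (\<lambda>(x, t). t ^ m * h (c + t *\<^sub>R (x - c)))"
  unfolding split_def
  by (intro continuous_intros continuous_on_compose2[OF assms])
    (auto simp del: mem_ball intro: ball_ray_mem)

text \<open>The weight \<open>t ^ m\<close> is there for the induction: differentiating in
  \<open>x\<close> under the integral brings out one more factor \<open>t\<close>, so
  \<open>m\<close> becomes \<open>Suc m\<close>.\<close>

lemma Ck_on_ray_integral:
  fixes h :: "'a::euclidean_space \<Rightarrow> real"
  assumes "Ck_on k (ball c r) h"
  shows "Ck_on k (ball c r) (\<lambda>x. integral {0..1} (\<lambda>t. t ^ m * h (c + t *\<^sub>R (x - c))))"
  using assms
proof (induction k arbitrary: h m)
  case 0
  then have "continuous_on (ball c r \<times> cbox 0 1) (\<lambda>(x, t). t ^ m * h (c + t *\<^sub>R (x - c)))"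
    by (simp add: continuous_on_ray)
  from integral_continuous_on_param[OF this] show ?case by simp
next
  case (Suc k)
  let ?D = "\<lambda>x t v. t ^ Suc m * frechet_derivative h (at (c + t *\<^sub>R (x - c))) v"
  \<comment> \<open>The Leibniz rule wants the derivative as a jointly continuous map into bounded
    linear functions. \<open>Blinfun\<close> is meaningful only where \<open>?D x t\<close> is
    bounded linear, that is for \<open>x\<close> in the ball and \<open>t\<close> in the unit
    interval.\<close>
  define L where "L x t = Blinfun (?D x t)" for x and t :: real
  have hd: "(h has_derivative frechet_derivative h (at (c + t *\<^sub>R (x - c)))) (at (c + t *\<^sub>R (x - c)))"
    if "x \<in> ball c r" "t \<in> {0..1}" for x t
    by (rule Ck_on_Suc_has_derivative[OF Suc.prems ball_ray_mem[OF that]])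
  have bl: "bounded_linear (?D x t)" if "x \<in> ball c r" "t \<in> {0..1}" for x t
    using has_derivative_bounded_linear[OF hd[OF that]] by (rule bounded_linear_const_mult)
  have L: "blinfun_apply (L x t) = ?D x t" if "x \<in> ball c r" "t \<in> {0..1}" for x t
    unfolding L_def by (rule bounded_linear_Blinfun_apply[OF bl[OF that]])
  have contD: "continuous_on (ball c r \<times> {0..1}) (\<lambda>(x, t). ?D x t v)" for v
    by (rule continuous_on_ray, rule Ck_on_imp_continuous_on[of k]) (use Suc.prems in auto)
  have "continuous_on (ball c r \<times> {0..1}) (\<lambda>z. blinfun_apply (L (fst z) (snd z)) v)" for v
    using contD[of v] by (rule continuous_on_eq) (auto simp: L)
  then have contL: "continuous_on (ball c r \<times> cbox 0 1) (\<lambda>(x, t). L x t)"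
    by (auto simp: split_def intro: continuous_on_blinfun_componentwise)
  have cont_h: "continuous_on (ball c r \<times> {0..1}) (\<lambda>(x, t). t ^ m * h (c + t *\<^sub>R (x - c)))"
    by (rule continuous_on_ray) (use Suc.prems Ck_on_imp_continuous_on in blast)
  show ?case
  proof (rule Ck_on_SucI)
    fix x assume x: "x \<in> ball c r"
    have "((\<lambda>x. integral (cbox 0 1) (\<lambda>t. t ^ m * h (c + t *\<^sub>R (x - c))))
        has_derivative blinfun_apply (integral (cbox 0 1) (L x))) (at x within ball c r)"
    proof (rule leibniz_rule[OF _ _ contL x convex_ball])
      fix y :: 'a and t :: real assume y: "y \<in> ball c r" and t: "t \<in> cbox 0 1"
      then have t': "t \<in> {0..1}" by simp
      have "((\<lambda>y. c + t *\<^sub>R (y - c)) has_derivative (\<lambda>v. t *\<^sub>R v)) (at y)"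
        by (auto intro!: derivative_eq_intros)
      from has_derivative_compose[OF this hd[OF y t']]
      have "((\<lambda>y. t ^ m * h (c + t *\<^sub>R (y - c))) has_derivative
        (\<lambda>v. t ^ m * frechet_derivative h (at (c + t *\<^sub>R (y - c))) (t *\<^sub>R v))) (at y)"
        by (rule has_derivative_mult_right)
      then have "((\<lambda>y. t ^ m * h (c + t *\<^sub>R (y - c))) has_derivative ?D y t) (at y)"
        using has_derivative_linear[OF hd[OF y t']] by (simp add: linear_cmul mult_ac)
      then show "((\<lambda>y. t ^ m * h (c + t *\<^sub>R (y - c))) has_derivative blinfun_apply (L y t))
          (at y within ball c r)"
        using L[OF y t'] by (simp add: has_derivative_at_withinI)
    next
      fix y assume "y \<in> ball c r"
      then show "(\<lambda>t. t ^ m * h (c + t *\<^sub>R (y - c))) integrable_on cbox 0 1"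
        by (intro integrable_continuous continuous_on_compose2[OF cont_h, of _ "\<lambda>t. (y, t)", simplified])
          (auto intro!: continuous_intros)
    qed
    moreover have "L x integrable_on cbox 0 1"
      using x by (intro integrable_continuous continuous_on_compose2[OF contL, of _ "\<lambda>t. (x, t)", simplified])
        (auto intro!: continuous_intros)
    then have "blinfun_apply (integral (cbox 0 1) (L x)) = (\<lambda>v. integral {0..1} (\<lambda>t. ?D x t v))"
      by (intro ext, subst blinfun_apply_integral) (use L[OF x] in \<open>auto intro!: integral_cong\<close>)
    ultimately show "((\<lambda>x. integral {0..1} (\<lambda>t. t ^ m * h (c + t *\<^sub>R (x - c)))) has_derivative
        (\<lambda>v. integral {0..1} (\<lambda>t. ?D x t v))) (at x)"
      by (simp add: at_within_open[OF x open_ball])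
  next
    show "Ck_on k (ball c r) (\<lambda>x. integral {0..1} (\<lambda>t. ?D x t v))" for v
      by (rule Suc.IH) (use Suc.prems in auto)
  qed simp
qed

text \<open>The fundamental theorem of calculus along the segment from \<open>c\<close> to
  \<open>x\<close> writes \<open>f x - f c\<close> as an integral of directional derivatives;
  expanding \<open>x - c\<close> in the basis makes \<open>G b\<close> the mean of the
  \<open>b\<close>-th partial derivative over that segment.\<close>

lemma hadamard:
  fixes f :: "'a::euclidean_space \<Rightarrow> real"
  assumes "smooth_on (ball c r) f"
  obtains G where "\<And>b. smooth_on (ball c r) (G b)"
    "\<And>b. G b c = frechet_derivative f (at c) b"
    "\<And>x. x \<in> ball c r \<Longrightarrow> f x = f c + (\<Sum>b\<in>Basis. ((x - c) \<bullet> b) * G b x)"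
proof -
  let ?D = "\<lambda>x t. frechet_derivative f (at (c + t *\<^sub>R (x - c)))"
  \<comment> \<open>The factor \<open>t ^ 0\<close> makes this the case \<open>m = 0\<close> of the
    ray integral.\<close>
  define G where "G b x = integral {0..1} (\<lambda>t. t ^ 0 * ?D x t b)" for b x
  have 1: "smooth_on (ball c r) (G b)" for b
    unfolding G_def
    by (rule smooth_onI, rule Ck_on_ray_integral, rule smooth_onD,
        rule smooth_on_frechet_derivative, rule assms)
  have 2: "G b c = frechet_derivative f (at c) b" for b
    by (simp add: G_def)
  have 3: "f x = f c + (\<Sum>b\<in>Basis. ((x - c) \<bullet> b) * G b x)" if x: "x \<in> ball c r" for x
  proof -
    have hd: "(f has_derivative ?D x t) (at (c + t *\<^sub>R (x - c)))" if "t \<in> {0..1}" for t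
      by (rule smooth_on_has_derivative[OF assms(1) ball_ray_mem[OF x that]])
    have "((\<lambda>t. ?D x t (x - c)) has_integral
        f (c + 1 *\<^sub>R (x - c)) - f (c + 0 *\<^sub>R (x - c))) {0..1}"
    proof (rule fundamental_theorem_of_calculus)
      fix t :: real assume t: "t \<in> {0..1}"
      have "((\<lambda>t. c + t *\<^sub>R (x - c)) has_derivative (\<lambda>s. s *\<^sub>R (x - c))) (at t)"
        by (auto intro!: derivative_eq_intros)
      from has_derivative_compose[OF this hd[OF t]]
      have "((\<lambda>t. f (c + t *\<^sub>R (x - c))) has_derivative (\<lambda>s. s *\<^sub>R ?D x t (x - c))) (at t)"
        using has_derivative_linear[OF hd[OF t]] by (simp add: linear_cmul)
      then show "((\<lambda>t. f (c + t *\<^sub>R (x - c))) has_vector_derivative ?D x t (x - c)) (at t within {0..1})"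
        by (simp add: has_vector_derivative_def has_derivative_at_withinI)
    qed simp
    then have "((\<lambda>t. \<Sum>b\<in>Basis. ((x - c) \<bullet> b) * ?D x t b) has_integral f x - f c) {0..1}"
    proof (subst has_integral_cong[symmetric])
      show "?D x t (x - c) = (\<Sum>b\<in>Basis. ((x - c) \<bullet> b) * ?D x t b)" if "t \<in> {0..1}" for t
        by (subst (2) euclidean_representation[symmetric, of "x - c"])
          (simp add: linear_sum linear_cmul has_derivative_linear[OF hd[OF that]])
    qed simp
    moreover have "((\<lambda>t. \<Sum>b\<in>Basis. ((x - c) \<bullet> b) * ?D x t b) has_integral
        (\<Sum>b\<in>Basis. ((x - c) \<bullet> b) * G b x)) {0..1}"
    proof (intro has_integral_sum has_integral_mult_right finite_Basis)
      fix b :: 'a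
      have "continuous_on (ball c r) (\<lambda>x. frechet_derivative f (at x) b)"
        by (intro smooth_on_imp_continuous_on smooth_on_frechet_derivative assms)
      then have "continuous_on {0..1} (\<lambda>t. ?D x t b)"
        by (rule continuous_on_compose2)
          (auto intro!: continuous_intros simp del: mem_ball intro: ball_ray_mem[OF x])
      then show "((\<lambda>t. ?D x t b) has_integral G b x) {0..1}"
        unfolding G_def using integrable_continuous_interval integrable_integral by fastforce
    qed
    ultimately have "f x - f c = (\<Sum>b\<in>Basis. ((x - c) \<bullet> b) * G b x)"
      by (rule has_integral_unique)
    then show ?thesis by simp
  qed
  show ?thesis by (rule that[OF 1 2 3])
qed

section \<open>Smooth functions and tangent vectors on manifolds\<close>

lemma chartD:
  assumes "smooth_manifold A" "(U, \<kappa>) \<in> A"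
  shows "open U" "open (\<kappa> ` U)" "homeomorphism U (\<kappa> ` U) \<kappa> (inv_into U \<kappa>)"
    "\<And>q. q \<in> U \<Longrightarrow> inv_into U \<kappa> (\<kappa> q) = q"
proof -
  have "is_chart (U, \<kappa>)" using assms by (auto simp: smooth_manifold_def)
  then show "open U" "open (\<kappa> ` U)" and h: "homeomorphism U (\<kappa> ` U) \<kappa> (inv_into U \<kappa>)"
    by (auto simp: is_chart_def)
  show "inv_into U \<kappa> (\<kappa> q) = q" if "q \<in> U" for q
    using h that by (rule homeomorphism_apply1)
qed

lemma chart_image_open:
  assumes "smooth_manifold A" "(U, \<kappa>) \<in> A" "open W" "W \<subseteq> U"
  shows "open (\<kappa> ` W)"
  using homeomorphism_imp_open_map[OF chartD(3)[OF assms(1,2)], of W] assms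
    chartD(1,2)[OF assms(1,2)] by (simp add: openin_open_eq)

lemma chart_at:
  assumes "smooth_manifold A"
  obtains U \<kappa> where "(U, \<kappa>) \<in> A" "p \<in> U"
proof -
  have "p \<in> (\<Union>(U, \<kappa>)\<in>A. U)" using assms by (simp add: smooth_manifold_def)
  then show ?thesis using that by auto
qed

lemma smooth_fun_chart:
  "smooth_fun A f \<Longrightarrow> (U, \<kappa>) \<in> A \<Longrightarrow> smooth_on (\<kappa> ` U) (f \<circ> inv_into U \<kappa>)"
  by (auto simp: smooth_fun_def)

text \<open>One convenient chart near each point is enough: composing with the smooth transition map
  carries smoothness to every other chart of the atlas.\<close>

lemma smooth_fun_local:
  fixes A :: "('m::{t2_space, second_countable_topology}, 'e::euclidean_space) chart set"
  assumes A: "smooth_manifold A"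
    and loc: "\<And>p. \<exists>U \<kappa> W. (U, \<kappa>) \<in> A \<and> open W \<and> W \<subseteq> U \<and> p \<in> W \<and>
      smooth_on (\<kappa> ` W) (f \<circ> inv_into U \<kappa>)"
  shows "smooth_fun A f"
proof -
  have "smooth_on (\<mu> ` V) (f \<circ> inv_into V \<mu>)" if V: "(V, \<mu>) \<in> A" for V \<mu>
  proof (rule smooth_on_local)
    fix x assume "x \<in> \<mu> ` V"
    then obtain p where p: "p \<in> V" "x = \<mu> p" by blast
    obtain U \<kappa> W where U: "(U, \<kappa>) \<in> A" and W: "open W" "W \<subseteq> U" "p \<in> W"
      "smooth_on (\<kappa> ` W) (f \<circ> inv_into U \<kappa>)" using loc by blast
    let ?T = "\<mu> ` (W \<inter> V)"
    note invV = chartD(4)[OF A V] and invU = chartD(4)[OF A U]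
    have T: "open ?T"
      using chart_image_open[OF A V] W(1) chartD(1)[OF A V] by auto
    have "smooth_on (\<mu> ` (V \<inter> U)) (\<kappa> \<circ> inv_into V \<mu>)"
      using A U V unfolding smooth_manifold_def by blast
    then have "smooth_on ?T (\<kappa> \<circ> inv_into V \<mu>)"
      by (rule smooth_on_subset) (use W in auto)
    then have "smooth_on ?T (\<lambda>y. (f \<circ> inv_into U \<kappa>) ((\<kappa> \<circ> inv_into V \<mu>) y))"
      using W(4) by (intro smooth_on_compose[OF T chart_image_open[OF A U W(1,2)]])
        (auto simp: invV comp_def)
    then have "smooth_on ?T (f \<circ> inv_into V \<mu>)"
      by (rule smooth_on_cong[OF T, rotated]) (use W in \<open>auto simp: invV invU\<close>)
    then show "\<exists>T. open T \<and> x \<in> T \<and> smooth_on T (f \<circ> inv_into V \<mu>)"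
      using T p W by blast
  qed
  then show ?thesis by (auto simp: smooth_fun_def)
qed

lemma smooth_fun_const: "smooth_fun A (\<lambda>q. c)"
  by (auto simp: smooth_fun_def comp_def smooth_on_const)

lemma smooth_fun_add:
  "smooth_manifold A \<Longrightarrow> smooth_fun A f \<Longrightarrow> smooth_fun A h \<Longrightarrow> smooth_fun A (\<lambda>q. f q + h q)"
  using chartD(2) by (fastforce simp: smooth_fun_def comp_def intro!: smooth_on_add)

lemma smooth_fun_mult:
  "smooth_manifold A \<Longrightarrow> smooth_fun A f \<Longrightarrow> smooth_fun A h \<Longrightarrow> smooth_fun A (\<lambda>q. f q * h q)"
  using chartD(2) by (fastforce simp: smooth_fun_def comp_def intro!: smooth_on_mult)

lemma smooth_fun_sum:
  "smooth_manifold A \<Longrightarrow> (\<And>i. i \<in> I \<Longrightarrow> smooth_fun A (f i)) \<Longrightarrow> smooth_fun A (\<lambda>q. \<Sum>i\<in>I. f i q)"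
  by (induction I rule: infinite_finite_induct) (auto intro: smooth_fun_const smooth_fun_add)

text \<open>Near a point outside \<open>U\<close> the extension has to vanish on a whole
  neighbourhood. This holds because the function lives on the preimage of a closed ball inside the
  chart image.\<close>

lemma smooth_fun_extend:
  fixes A :: "('m::{t2_space, second_countable_topology}, 'e::euclidean_space) chart set"
  assumes A: "smooth_manifold A" and U: "(U, \<kappa>) \<in> A"
    and g: "smooth_on UNIV g" and 0: "\<And>x. x \<notin> cball c r \<Longrightarrow> g x = 0"
    and sub: "cball c r \<subseteq> \<kappa> ` U"
  shows "smooth_fun A (\<lambda>q. if q \<in> U then g (\<kappa> q) else 0)" (is "smooth_fun A ?f")
proof (rule smooth_fun_local[OF A])
  fix p
  note inv = chartD(4)[OF A U]
  show "\<exists>U \<kappa> W. (U, \<kappa>) \<in> A \<and> open W \<and> W \<subseteq> U \<and> p \<in> W \<and> smooth_on (\<kappa> ` W) (?f \<circ> inv_into U \<kappa>)"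
  proof (cases "p \<in> U")
    case True
    have "smooth_on (\<kappa> ` U) (?f \<circ> inv_into U \<kappa>)"
      by (rule smooth_on_cong[OF chartD(2)[OF A U] _ smooth_on_subset[OF g]]) (auto simp: inv)
    then show ?thesis using U True chartD(1)[OF A U] by blast
  next
    case False
    obtain V \<mu> where V: "(V, \<mu>) \<in> A" "p \<in> V" using chart_at[OF A] .
    let ?K = "inv_into U \<kappa> ` cball c r"
    have "continuous_on (cball c r) (inv_into U \<kappa>)"
      using chartD(3)[OF A U] sub by (meson homeomorphism_def continuous_on_subset)
    \<comment> \<open>Compactness of the ball together with the Hausdorff property gives closedness
      in the whole manifold, not just in \<open>U\<close>.\<close>
    then have "closed ?K"
      by (intro compact_imp_closed compact_continuous_image compact_cball)
    moreover have "?K \<subseteq> U" using sub by (auto simp del: mem_cball intro!: inv_into_into)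
    ultimately have W: "open (V - ?K)" "p \<in> V - ?K"
      using V False chartD(1)[OF A V(1)] by auto
    have "g (\<kappa> q) = 0" if "q \<in> U" "q \<notin> ?K" for q
      using that 0[of "\<kappa> q"] inv[of q] by (metis imageI)
    then have "smooth_on (\<mu> ` (V - ?K)) (?f \<circ> inv_into V \<mu>)"
      by (intro smooth_on_cong[OF chart_image_open[OF A V(1) W(1)] _ smooth_on_const[of _ 0]])
        (auto simp: chartD(4)[OF A V(1)])
    then show ?thesis using V W by blast
  qed
qed

lemma smooth_fun_comp:
  fixes A :: "('m::{t2_space, second_countable_topology}, 'e::euclidean_space) chart set"
    and B :: "('n::{t2_space, second_countable_topology}, 'k::euclidean_space) chart set"
  assumes A: "smooth_manifold A" and B: "smooth_manifold B"
    and F: "smooth_map A B F" and h: "smooth_fun B h"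
  shows "smooth_fun A (h \<circ> F)"
proof (rule smooth_fun_local[OF A])
  fix p
  obtain U \<kappa> where U: "(U, \<kappa>) \<in> A" "p \<in> U" using chart_at[OF A] .
  obtain V \<mu> where V: "(V, \<mu>) \<in> B" "F p \<in> V" using chart_at[OF B] .
  let ?W = "U \<inter> F -` V"
  have "open (F -` V)"
    using F chartD(1)[OF B V(1)] by (auto simp: smooth_map_def intro: open_vimage)
  then have W: "open ?W" using chartD(1)[OF A U(1)] by auto
  have oW: "open (\<kappa> ` ?W)" by (rule chart_image_open[OF A U(1) W]) auto
  have "smooth_on (\<kappa> ` ?W) (\<mu> \<circ> F \<circ> inv_into U \<kappa>)"
    using F U V unfolding smooth_map_def by blast
  then have "smooth_on (\<kappa> ` ?W) (\<lambda>y. (h \<circ> inv_into V \<mu>) ((\<mu> \<circ> F \<circ> inv_into U \<kappa>) y))"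
    using smooth_fun_chart[OF h V(1)]
    by (intro smooth_on_compose[OF oW chartD(2)[OF B V(1)]]) (auto simp: chartD(4)[OF A U(1)] comp_def)
  then have "smooth_on (\<kappa> ` ?W) (h \<circ> F \<circ> inv_into U \<kappa>)"
    by (rule smooth_on_cong[OF oW, rotated]) (auto simp: chartD(4)[OF A U(1)] chartD(4)[OF B V(1)])
  then show "\<exists>U \<kappa> W. (U, \<kappa>) \<in> A \<and> open W \<and> W \<subseteq> U \<and> p \<in> W \<and>
      smooth_on (\<kappa> ` W) (h \<circ> F \<circ> inv_into U \<kappa>)"
    using U V W by blast
qed

section \<open>Algebra of derivations and of smooth vector fields\<close>

lemma tangent_add:
  "v \<in> tangent_space A p \<Longrightarrow> smooth_fun A f \<Longrightarrow> smooth_fun A h \<Longrightarrow> v (\<lambda>x. f x + h x) = v f + v h"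
  by (simp add: tangent_space_def plus_fun_def)

lemma tangent_scale:
  "v \<in> tangent_space A p \<Longrightarrow> smooth_fun A f \<Longrightarrow> v (\<lambda>x. a * f x) = a * v f"
  by (simp add: tangent_space_def scale_fun_def)

lemma tangent_mult:
  "v \<in> tangent_space A p \<Longrightarrow> smooth_fun A f \<Longrightarrow> smooth_fun A h \<Longrightarrow>
    v (\<lambda>x. f x * h x) = f p * v h + h p * v f"
  by (simp add: tangent_space_def times_fun_def)

lemma tangent_not_smooth: "v \<in> tangent_space A p \<Longrightarrow> \<not> smooth_fun A f \<Longrightarrow> v f = 0"
  by (simp add: tangent_space_def)

text \<open>The Leibniz rule applied to \<open>1 * 1\<close> gives
  \<open>v 1 = 2 * v 1\<close>.\<close>

lemma tangent_const:
  assumes "v \<in> tangent_space A p"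
  shows "v (\<lambda>x. c) = 0"
proof -
  have "v (\<lambda>x. 1) = 0"
    using tangent_mult[OF assms smooth_fun_const[of A 1] smooth_fun_const[of A 1]] by simp
  then show ?thesis
    using tangent_scale[OF assms smooth_fun_const[of A 1], of c] by simp
qed

lemma tangent_sum:
  assumes "smooth_manifold A" "v \<in> tangent_space A p" "\<And>i. i \<in> I \<Longrightarrow> smooth_fun A (f i)"
  shows "v (\<lambda>x. \<Sum>i\<in>I. f i x) = (\<Sum>i\<in>I. v (f i))"
  using assms(3)
  by (induction I rule: infinite_finite_induct)
    (simp_all add: tangent_const[OF assms(2)] tangent_add[OF assms(2)] smooth_fun_sum[OF assms(1)])

lemma tangent_spaceI:
  assumes "\<And>f h. smooth_fun A f \<Longrightarrow> smooth_fun A h \<Longrightarrow> v (\<lambda>x. f x + h x) = v f + v h"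
    "\<And>a f. smooth_fun A f \<Longrightarrow> v (\<lambda>x. a * f x) = a * v f"
    "\<And>f h. smooth_fun A f \<Longrightarrow> smooth_fun A h \<Longrightarrow> v (\<lambda>x. f x * h x) = f p * v h + h p * v f"
    "\<And>f. \<not> smooth_fun A f \<Longrightarrow> v f = 0"
  shows "v \<in> tangent_space A p"
  using assms by (simp add: tangent_space_def plus_fun_def times_fun_def scale_fun_def)

lemma tangent_space_lincomb:
  assumes "u \<in> tangent_space A p" "v \<in> tangent_space A p"
  shows "(\<lambda>f. a * u f + b * v f) \<in> tangent_space A p"
  by (rule tangent_spaceI)
    (simp_all add: assms[THEN tangent_add] assms[THEN tangent_scale] assms[THEN tangent_mult]
      assms[THEN tangent_not_smooth] algebra_simps)

lemma tangent_space_zero: "(\<lambda>f. 0) \<in> tangent_space A p"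
  by (rule tangent_spaceI) simp_all

lemma smooth_vfield_lincomb:
  assumes A: "smooth_manifold A" and X: "smooth_vfield A X" and Y: "smooth_vfield A Y"
    and a: "smooth_fun A a" and b: "smooth_fun A b"
  shows "smooth_vfield A (\<lambda>p f. a p * X p f + b p * Y p f)"
proof -
  have "smooth_fun A (\<lambda>p. a p * X p f + b p * Y p f)" if "smooth_fun A f" for f
    using X Y that
    by (intro smooth_fun_add[OF A] smooth_fun_mult[OF A] a b)
      (auto simp: smooth_vfield_def apply_vfield_def)
  then show ?thesis
    using X Y by (auto simp: smooth_vfield_def apply_vfield_def intro: tangent_space_lincomb)
qed

lemma smooth_vfield_zero: "smooth_vfield A (\<lambda>p f. 0)"
  by (simp add: smooth_vfield_def apply_vfield_def tangent_space_zero smooth_fun_const)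

lemma smooth_vfield_const_lincomb:
  assumes A: "smooth_manifold A" and X: "\<And>i. i \<in> I \<Longrightarrow> smooth_vfield A (X i)"
  shows "smooth_vfield A (\<lambda>p f. \<Sum>i\<in>I. c i * X i p f)"
  using X
proof (induction I rule: infinite_finite_induct)
  case (insert i I)
  have "smooth_vfield A (\<lambda>p f. c i * X i p f + 1 * (\<Sum>i\<in>I. c i * X i p f))"
    using insert by (intro smooth_vfield_lincomb[OF A] smooth_fun_const) auto
  then show ?case using insert by simp
qed (simp_all add: smooth_vfield_zero)

text \<open>The factor \<open>a\<close> is a slot for the value of a cutoff at \<open>q\<close>; the
  conditional supplies the convention that tangent vectors vanish at non-smooth functions.\<close>

lemma chart_derivative_in_tangent_space:
  assumes A: "smooth_manifold A" and U: "(U, \<kappa>) \<in> A" and q: "q \<in> U"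
  shows "(\<lambda>f. if smooth_fun A f then a * frechet_derivative (f \<circ> inv_into U \<kappa>) (at (\<kappa> q)) b else 0)
    \<in> tangent_space A q" (is "?v \<in> _")
proof -
  let ?D = "\<lambda>f. frechet_derivative (f \<circ> inv_into U \<kappa>) (at (\<kappa> q))"
  have hd: "(f \<circ> inv_into U \<kappa> has_derivative ?D f) (at (\<kappa> q))" if "smooth_fun A f" for f
    using smooth_on_has_derivative[OF smooth_fun_chart[OF that U]] q by blast
  note at = hd[unfolded comp_def] and inv = chartD(4)[OF A U q]
  show ?thesis
  proof (rule tangent_spaceI)
    fix f h :: "'a \<Rightarrow> real" and c assume f: "smooth_fun A f" and h: "smooth_fun A h"
    have "?D (\<lambda>x. f x + h x) = (\<lambda>v. ?D f v + ?D h v)"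
      using has_derivative_add[OF at[OF f] at[OF h]]
      by (simp add: comp_def frechet_derivative_at[symmetric])
    then show "?v (\<lambda>x. f x + h x) = ?v f + ?v h"
      using f h smooth_fun_add[OF A f h] by (simp add: distrib_left)
    have "?D (\<lambda>x. f x * h x) = (\<lambda>v. f q * ?D h v + ?D f v * h q)"
      using has_derivative_mult[OF at[OF f] at[OF h]]
      by (simp add: comp_def frechet_derivative_at[symmetric] inv)
    then show "?v (\<lambda>x. f x * h x) = f q * ?v h + h q * ?v f"
      using f h smooth_fun_mult[OF A f h] by (simp add: algebra_simps)
  next
    fix f :: "'a \<Rightarrow> real" and c assume f: "smooth_fun A f"
    have "?D (\<lambda>x. c * f x) = (\<lambda>v. c * ?D f v)"
      using has_derivative_mult_right[OF at[OF f], of c]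
      by (simp add: comp_def frechet_derivative_at[symmetric])
    then show "?v (\<lambda>x. c * f x) = c * ?v f"
      using f smooth_fun_mult[OF A smooth_fun_const f, of c] by simp
  qed simp
qed

section \<open>Extension of tangent vectors\<close>

text \<open>The functions \<open>h b\<close> are global stand-ins for the coordinates, equal to them
  only near \<open>q\<close>. Applying \<open>v\<close> to Hadamard's expansion of \<open>f\<close>,
  made global by a cutoff, leaves exactly the first-order terms.\<close>

lemma tangent_vector_representation:
  fixes A :: "('m::{t2_space, second_countable_topology}, 'e::euclidean_space) chart set"
  assumes A: "smooth_manifold A" and U: "(U, \<kappa>) \<in> A" and q: "q \<in> U"
    and W: "open W" "W \<subseteq> \<kappa> ` U" "\<kappa> q \<in> W"
    and h: "\<And>b. b \<in> Basis \<Longrightarrow> smooth_fun A (h b)"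
      "\<And>b x. b \<in> Basis \<Longrightarrow> x \<in> U \<Longrightarrow> \<kappa> x \<in> W \<Longrightarrow> h b x = \<kappa> x \<bullet> b"
    and v: "v \<in> tangent_space A q" and f: "smooth_fun A f"
  shows "v f = (\<Sum>b\<in>Basis. v (h b) * frechet_derivative (f \<circ> inv_into U \<kappa>) (at (\<kappa> q)) b)"
proof -
  let ?f = "f \<circ> inv_into U \<kappa>" and ?y = "\<kappa> q"
  note inv = chartD(4)[OF A U]
  obtain s where s: "0 < s" "ball ?y s \<subseteq> W" using W openE by blast
  have "smooth_on (ball ?y s) ?f"
    by (rule smooth_on_subset[OF smooth_fun_chart[OF f U]]) (use s W in blast)
  from hadamard[OF this] obtain G where G: "\<And>b. smooth_on (ball ?y s) (G b)"
    "\<And>b. G b ?y = frechet_derivative ?f (at ?y) b"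
    "\<And>x. x \<in> ball ?y s \<Longrightarrow> ?f x = ?f ?y + (\<Sum>b\<in>Basis. ((x - ?y) \<bullet> b) * G b x)"
    by blast
  \<comment> \<open>The cutoff is 1 near the centre, and its support is a closed ball inside the
    open ball on which the expansion holds.\<close>
  have s4: "0 < s / 4" "s / 4 < s / 2" and ss: "cball ?y (s / 2) \<subseteq> ball ?y s"
    using s(1) by auto
  obtain \<psi> :: "'e \<Rightarrow> real" where \<psi>: "smooth_on UNIV \<psi>"
    "\<And>x. x \<in> cball ?y (s / 4) \<Longrightarrow> \<psi> x = 1" "\<And>x. x \<notin> cball ?y (s / 2) \<Longrightarrow> \<psi> x = 0"
    using obtain_bump[OF s4, of ?y] by blast
  have sub: "cball ?y (s / 2) \<subseteq> \<kappa> ` U" using ss s W by blast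
  define \<psi>' where "\<psi>' = (\<lambda>x. if x \<in> U then \<psi> (\<kappa> x) else 0)"
  define G' where "G' b = (\<lambda>x. if x \<in> U then \<psi> (\<kappa> x) * G b (\<kappa> x) else 0)" for b
  have \<psi>': "smooth_fun A \<psi>'"
    unfolding \<psi>'_def by (rule smooth_fun_extend[OF A U \<psi>(1) \<psi>(3) sub])
  have G': "smooth_fun A (G' b)" for b
    unfolding G'_def
    by (rule smooth_fun_extend[OF A U smooth_on_mult_cutoff[OF \<psi>(1,3) closed_cball ss open_ball G(1)] _ sub])
      (use \<psi>(3) in auto)
  have h': "smooth_fun A (\<lambda>x. h b x + - h b q)" if "b \<in> Basis" for b
    by (intro smooth_fun_add[OF A] h(1) smooth_fun_const that)
  have hG: "smooth_fun A (\<lambda>x. (h b x + - h b q) * G' b x)" if "b \<in> Basis" for b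
    by (intro smooth_fun_mult[OF A] h' G' that)
  have y1: "\<psi> ?y = 1" using \<psi>(2)[of ?y] s by simp
  \<comment> \<open>This is Hadamard's expansion times the cutoff; off the support both sides are 0,
    so it holds on all of \<open>M\<close>.\<close>
  have "\<psi>' x * f x = f q * \<psi>' x + (\<Sum>b\<in>Basis. (h b x + - h b q) * G' b x)" for x
  proof (cases "x \<in> U \<and> \<kappa> x \<in> cball ?y (s / 2)")
    case True
    then have b: "\<kappa> x \<in> ball ?y s" using ss by blast
    have hb: "h b x + - h b q = (\<kappa> x - ?y) \<bullet> b" if "b \<in> Basis" for b
      using h(2)[OF that] True q b s(2) W(3) by (auto simp: inner_diff_left)
    have "f x = f q + (\<Sum>b\<in>Basis. (h b x + - h b q) * G b (\<kappa> x))"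
      using G(3)[OF b] True q hb by (simp add: inv)
    then show ?thesis
      using True by (simp add: \<psi>'_def G'_def sum_distrib_left algebra_simps)
  next
    case False
    then have "\<psi>' x = 0" "G' b x = 0" for b using \<psi>(3)[of "\<kappa> x"] by (auto simp: \<psi>'_def G'_def)
    then show ?thesis by simp
  qed
  then have "v (\<lambda>x. \<psi>' x * f x) =
      v (\<lambda>x. f q * \<psi>' x + (\<Sum>b\<in>Basis. (h b x + - h b q) * G' b x))" by simp
  also have "\<dots> = f q * v \<psi>' + (\<Sum>b\<in>Basis. v (\<lambda>x. (h b x + - h b q) * G' b x))"
    by (simp only: tangent_add[OF v smooth_fun_mult[OF A smooth_fun_const \<psi>'] smooth_fun_sum[OF A hG]]
        tangent_scale[OF v \<psi>'] tangent_sum[OF A v hG])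
  also have "(\<Sum>b\<in>Basis. v (\<lambda>x. (h b x + - h b q) * G' b x)) =
      (\<Sum>b\<in>Basis. v (h b) * frechet_derivative ?f (at ?y) b)"
  proof (rule sum.cong)
    fix b :: 'e assume b: "b \<in> Basis"
    have "v (\<lambda>x. h b x + - h b q) = v (h b)"
      using tangent_add[OF v h(1)[OF b] smooth_fun_const[of A "- h b q"]] tangent_const[OF v] by simp
    \<comment> \<open>The first factor vanishes at \<open>q\<close>, so only the Leibniz term that
      differentiates it survives.\<close>
    then show "v (\<lambda>x. (h b x + - h b q) * G' b x) = v (h b) * frechet_derivative ?f (at ?y) b"
      using tangent_mult[OF v h'[OF b] G'[of b]] q by (simp add: G'_def y1 G(2))
  qed simp
  also have "v (\<lambda>x. \<psi>' x * f x) = v f + f q * v \<psi>'"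
    using tangent_mult[OF v \<psi>' f] q by (simp add: \<psi>'_def y1)
  finally show ?thesis by (simp add: comp_def)
qed

text \<open>Coordinate derivatives and coordinate functions are cut off by the same
  \<open>\<beta>1\<close>, which is 1 over \<open>W\<close>. So globally defined objects behave
  there like a chart, and \<open>\<beta>\<close> serves to discard what happens off
  \<open>W\<close>.\<close>

lemma obtain_local_frame:
  fixes A :: "('m::{t2_space, second_countable_topology}, 'e::euclidean_space) chart set"
  assumes A: "smooth_manifold A"
  obtains \<beta> :: "'m \<Rightarrow> real" and W and h :: "'e \<Rightarrow> 'm \<Rightarrow> real" and E :: "'e \<Rightarrow> 'm vfield" where
    "smooth_fun A \<beta>" "\<beta> p = 1" "\<And>q. q \<notin> W \<Longrightarrow> \<beta> q = 0" "p \<in> W"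
    "\<And>b. smooth_fun A (h b)" "\<And>b. smooth_vfield A (E b)"
    "\<And>b c. b \<in> Basis \<Longrightarrow> c \<in> Basis \<Longrightarrow> E b p (h c) = (if b = c then 1 else 0)"
    "\<And>q v f. q \<in> W \<Longrightarrow> v \<in> tangent_space A q \<Longrightarrow> v f = (\<Sum>b\<in>Basis. v (h b) * E b q f)"
proof -
  obtain U \<kappa> where U: "(U, \<kappa>) \<in> A" "p \<in> U" using chart_at[OF A] .
  note inv = chartD(4)[OF A U(1)]
  obtain e where e: "0 < e" "cball (\<kappa> p) e \<subseteq> \<kappa> ` U"
    using chartD(2)[OF A U(1)] U(2) open_contains_cball by blast
  obtain \<beta>1 :: "'e \<Rightarrow> real" where \<beta>1: "smooth_on UNIV \<beta>1"
    "\<And>x. x \<in> cball (\<kappa> p) (e / 2) \<Longrightarrow> \<beta>1 x = 1" "\<And>x. x \<notin> cball (\<kappa> p) e \<Longrightarrow> \<beta>1 x = 0"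
    using obtain_bump[of "e / 2" e "\<kappa> p"] e(1) by auto
  obtain \<beta>2 :: "'e \<Rightarrow> real" where \<beta>2: "smooth_on UNIV \<beta>2"
    "\<And>x. x \<in> cball (\<kappa> p) (e / 8) \<Longrightarrow> \<beta>2 x = 1" "\<And>x. x \<notin> cball (\<kappa> p) (e / 4) \<Longrightarrow> \<beta>2 x = 0"
    using obtain_bump[of "e / 8" "e / 4" "\<kappa> p"] e(1) by auto
  \<comment> \<open>The radius \<open>e / 2\<close> lies between the others: \<open>\<beta>1\<close>
    is 1 on this ball, while \<open>\<beta>2\<close> is already 0 off the closed ball of radius
    \<open>e / 4\<close>.\<close>
  define W where "W = {q \<in> U. \<kappa> q \<in> ball (\<kappa> p) (e / 2)}"
  define \<beta> where "\<beta> = (\<lambda>q. if q \<in> U then \<beta>2 (\<kappa> q) else 0)"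
  define h where "h b = (\<lambda>q. if q \<in> U then \<beta>1 (\<kappa> q) * (\<kappa> q \<bullet> b) else 0)" for b
  define E where "E b q f = (if q \<in> U then if smooth_fun A f then
      \<beta>1 (\<kappa> q) * frechet_derivative (f \<circ> inv_into U \<kappa>) (at (\<kappa> q)) b else 0 else 0)" for b q f
  have sub4: "cball (\<kappa> p) (e / 4) \<subseteq> \<kappa> ` U" and subW: "ball (\<kappa> p) (e / 2) \<subseteq> \<kappa> ` U"
    using e by (auto intro!: subsetD[OF e(2)])
  have \<beta>1W: "\<beta>1 (\<kappa> q) = 1" if "q \<in> W" for q
    using that by (intro \<beta>1(2)) (auto simp: W_def)
  have 1: "smooth_fun A \<beta>"
    unfolding \<beta>_def by (rule smooth_fun_extend[OF A U(1) \<beta>2(1,3) sub4])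
  have 2: "\<beta> p = 1" using U(2) e(1) \<beta>2(2) by (simp add: \<beta>_def)
  have 3: "\<beta> q = 0" if "q \<notin> W" for q
    using that e(1) \<beta>2(3)[of "\<kappa> q"] by (auto simp: \<beta>_def W_def)
  have 4: "p \<in> W" using U(2) e(1) by (simp add: W_def)
  have 5: "smooth_fun A (h b)" for b
    unfolding h_def
    by (rule smooth_fun_extend[OF A U(1) smooth_on_mult[OF open_UNIV \<beta>1(1)
            smooth_on_bounded_linear[OF bounded_linear_inner_left]] _ e(2)])
      (use \<beta>1(3) in auto)
  have tan: "E b q \<in> tangent_space A q" for b q
    using chart_derivative_in_tangent_space[OF A U(1), of q "\<beta>1 (\<kappa> q)" b]
      tangent_space_zero[of A q]
    by (cases "q \<in> U") (simp_all add: E_def[abs_def])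
  have 6: "smooth_vfield A (E b)" for b
  proof -
    have "smooth_fun A (\<lambda>q. E b q f)" if f: "smooth_fun A f" for f
    proof -
      have "smooth_fun A (\<lambda>q. if q \<in> U then \<beta>1 (\<kappa> q) *
          frechet_derivative (f \<circ> inv_into U \<kappa>) (at (\<kappa> q)) b else 0)"
        by (rule smooth_fun_extend[OF A U(1) smooth_on_mult_cutoff[OF \<beta>1(1,3) closed_cball e(2)
                chartD(2)[OF A U(1)] smooth_on_frechet_derivative[OF smooth_fun_chart[OF f U(1)]]] _ e(2)])
          (use \<beta>1(3) in auto)
      then show ?thesis using f by (simp add: E_def cong: if_cong)
    qed
    then show ?thesis
      by (auto simp: smooth_vfield_def apply_vfield_def tan)
  qed
  have 7: "E b p (h c) = (if b = c then 1 else 0)" if "b \<in> Basis" "c \<in> Basis" for b c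
  proof -
    have "((\<lambda>x. x \<bullet> c) has_derivative (\<lambda>x. x \<bullet> c)) (at (\<kappa> p))"
      by (intro bounded_linear_imp_has_derivative bounded_linear_inner_left)
    then have "(h c \<circ> inv_into U \<kappa> has_derivative (\<lambda>x. x \<bullet> c)) (at (\<kappa> p))"
    proof (rule has_derivative_transform_within_open[OF _ open_ball])
      show "\<kappa> p \<in> ball (\<kappa> p) (e / 2)" using e(1) by simp
      show "x \<bullet> c = (h c \<circ> inv_into U \<kappa>) x" if x: "x \<in> ball (\<kappa> p) (e / 2)" for x
      proof -
        obtain q where q: "q \<in> U" "x = \<kappa> q" using x subW by blast
        then show ?thesis using x \<beta>1W[of q] by (simp add: h_def inv W_def)
      qed
    qed
    then show ?thesis
      using that 5 \<beta>1W[OF 4] U(2) by (simp add: E_def frechet_derivative_at[symmetric] inner_Basis)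
  qed
  have 8: "v f = (\<Sum>b\<in>Basis. v (h b) * E b q f)" if q: "q \<in> W" and v: "v \<in> tangent_space A q" for q v f
  proof (cases "smooth_fun A f")
    case True
    have "v f = (\<Sum>b\<in>Basis. v (h b) * frechet_derivative (f \<circ> inv_into U \<kappa>) (at (\<kappa> q)) b)"
      using q \<beta>1W
      by (intro tangent_vector_representation[OF A U(1) _ open_ball subW _ 5 _ v True])
        (auto simp: W_def h_def)
    then show ?thesis using True q \<beta>1W[OF q] by (simp add: E_def W_def)
  next
    case False
    then show ?thesis by (simp add: E_def tangent_not_smooth[OF v] cong: if_cong)
  qed
  show ?thesis by (rule that[OF 1 2 3 4 5 6 7 8])
qed

text \<open>The coefficients of \<open>u\<close> in the local frame are kept constant.\<close>

lemma tangent_vector_extends: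
  fixes A :: "('m::{t2_space, second_countable_topology}, 'e::euclidean_space) chart set"
  assumes A: "smooth_manifold A" and u: "u \<in> tangent_space A p"
  obtains X where "smooth_vfield A X" "X p = u"
proof -
  obtain \<beta> W h and E :: "'e \<Rightarrow> 'm vfield" where "p \<in> W" "\<And>b. smooth_vfield A (E b)"
    "\<And>q v f. q \<in> W \<Longrightarrow> v \<in> tangent_space A q \<Longrightarrow> v f = (\<Sum>b\<in>Basis. v (h b) * E b q f)"
    using obtain_local_frame[OF A, of p] by metis
  then show ?thesis
    using u by (intro that[of "\<lambda>q f. \<Sum>b\<in>Basis. u (h b) * E b q f"]
        smooth_vfield_const_lincomb[OF A]) auto
qed

text \<open>If \<open>W\<close> extends a vector dual to \<open>H i\<close>, then \<open>W (H i) X - X (H i) W\<close> annihilates \<open>H i\<close>,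
  and at \<open>p\<close> it has the same value as \<open>X\<close>.\<close>

lemma annihilating_vfield_extends:
  fixes A :: "('m::{t2_space, second_countable_topology}, 'e::euclidean_space) chart set"
  assumes A: "smooth_manifold A" and "finite I" and "\<And>i. i \<in> I \<Longrightarrow> smooth_fun A (H i)"
    and "\<And>i. i \<in> I \<Longrightarrow> w i \<in> tangent_space A p"
    and "\<And>i j. i \<in> I \<Longrightarrow> j \<in> I \<Longrightarrow> w i (H j) = (if i = j then 1 else 0)"
    and "u \<in> tangent_space A p" "\<And>i. i \<in> I \<Longrightarrow> u (H i) = 0"
  shows "\<exists>X. smooth_vfield A X \<and> X p = u \<and> (\<forall>i\<in>I. \<forall>q. X q (H i) = 0)"
  using assms(2-)
proof (induction I arbitrary: u rule: finite_induct)
  case empty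
  then show ?case using tangent_vector_extends[OF A] by (metis empty_iff)
next
  case (insert i I)
  have "\<exists>X. smooth_vfield A X \<and> X p = u \<and> (\<forall>j\<in>I. \<forall>q. X q (H j) = 0)"
    by (rule insert.IH) (use insert.prems in auto)
  then obtain X where X: "smooth_vfield A X" "X p = u" "\<And>j q. j \<in> I \<Longrightarrow> X q (H j) = 0"
    by blast
  \<comment> \<open>A second use of the induction hypothesis, now for \<open>w i\<close> in place of
    \<open>u\<close>: by duality and \<open>i \<notin> I\<close> it annihilates every
    \<open>H j\<close> with \<open>j \<in> I\<close>.\<close>
  have "\<exists>W. smooth_vfield A W \<and> W p = w i \<and> (\<forall>j\<in>I. \<forall>q. W q (H j) = 0)"
    by (rule insert.IH) (use insert.prems insert.hyps in auto)
  then obtain W where W: "smooth_vfield A W" "W p = w i" "\<And>j q. j \<in> I \<Longrightarrow> W q (H j) = 0"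
    by blast
  \<comment> \<open>Multiplying \<open>X\<close> by \<open>W q (H i)\<close>, rather than dividing
    by it, avoids its possible zeros away from \<open>p\<close>. At \<open>p\<close> it equals 1,
    and \<open>X p (H i) = 0\<close>.\<close>
  define Z where "Z q f = W q (H i) * X q f + (- 1 * X q (H i)) * W q f" for q f
  have sm: "smooth_fun A (\<lambda>q. V q (H i))" if "smooth_vfield A V" for V
    using that insert.prems(1) by (simp add: smooth_vfield_def apply_vfield_def)
  have "smooth_vfield A Z"
    unfolding Z_def
    by (intro smooth_vfield_lincomb[OF A X(1) W(1)] smooth_fun_mult[OF A] smooth_fun_const sm X(1) W(1))
  moreover have "Z p = u"
    using insert.prems by (simp add: fun_eq_iff Z_def X W)
  moreover have "Z q (H j) = 0" if "j \<in> insert i I" for j q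
    using that X(3) W(3) by (auto simp: Z_def)
  ultimately show ?case by blast
qed

section \<open>Vertical vector fields\<close>

lemma vertical_vfield_extends:
  fixes A :: "('m::{t2_space, second_countable_topology}, 'e::euclidean_space) chart set"
    and B :: "('n::{t2_space, second_countable_topology}, 'k::euclidean_space) chart set"
  assumes A: "smooth_manifold A" and B: "smooth_manifold B" and F: "smooth_map A B F"
    and sub: "\<And>q. differential B F ` tangent_space A q = tangent_space B (F q)"
    and u: "u \<in> vertical A B F p"
  obtains X where "smooth_vfield A X" "X p = u" "\<And>q. X q \<in> vertical A B F q"
proof -
  obtain \<beta> W and h :: "'k \<Rightarrow> 'n \<Rightarrow> real" and E :: "'k \<Rightarrow> 'n vfield" where
    \<beta>: "smooth_fun B \<beta>" "\<beta> (F p) = 1" "\<And>y. y \<notin> W \<Longrightarrow> \<beta> y = 0" and "F p \<in> W"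
    and h: "\<And>b. smooth_fun B (h b)" and E: "\<And>b. smooth_vfield B (E b)"
      "\<And>b c. b \<in> Basis \<Longrightarrow> c \<in> Basis \<Longrightarrow> E b (F p) (h c) = (if b = c then 1 else 0)"
    and rep: "\<And>y v f. y \<in> W \<Longrightarrow> v \<in> tangent_space B y \<Longrightarrow> v f = (\<Sum>b\<in>Basis. v (h b) * E b y f)"
    by (rule obtain_local_frame[OF B, of "F p"]) blast
  \<comment> \<open>Maximal rank enters here: the frame of \<open>N\<close> at \<open>F p\<close>
    lifts to vectors at \<open>p\<close>, and these are dual to the pulled-back coordinates
    \<open>h b \<circ> F\<close>.\<close>
  have "E b (F p) \<in> differential B F ` tangent_space A p" for b
    using E(1)[of b] by (simp add: sub smooth_vfield_def)
  then have "\<exists>w. w \<in> tangent_space A p \<and> differential B F w = E b (F p)" for b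
    by (metis imageE)
  then obtain w where w: "\<And>b. w b \<in> tangent_space A p" "\<And>b. differential B F (w b) = E b (F p)"
    by metis
  have dh: "v (h b \<circ> F) = differential B F v (h b)" for v b
    using h by (simp add: differential_def)
  have "\<exists>X. smooth_vfield A X \<and> X p = u \<and> (\<forall>b\<in>Basis. \<forall>q. X q (h b \<circ> F) = 0)"
    by (rule annihilating_vfield_extends[OF A, of _ _ w])
      (use u in \<open>auto simp: dh w E(2) vertical_def intro: smooth_fun_comp[OF A B F h]\<close>)
  then obtain X where X: "smooth_vfield A X" "X p = u" "\<And>b q. b \<in> Basis \<Longrightarrow> X q (h b \<circ> F) = 0"
    by blast
  \<comment> \<open>The field \<open>X\<close> annihilates the pulled-back coordinates everywhere,
    but they determine the differential only over \<open>W\<close>; elsewhere the cutoff makes the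
    field 0. The zero summand merely fits the linear combination lemma.\<close>
  let ?X = "\<lambda>q f. (\<beta> \<circ> F) q * X q f + 0 * X q f"
  have sX: "smooth_vfield A ?X"
    by (intro smooth_vfield_lincomb[OF A X(1) X(1)] smooth_fun_comp[OF A B F \<beta>(1)] smooth_fun_const)
  show ?thesis
  proof (rule that[of ?X])
    show "?X p = u" using X(2) \<beta>(2) by (simp add: fun_eq_iff)
    show "?X q \<in> vertical A B F q" for q
    proof -
      have "differential B F (?X q) f = 0" for f
      proof (cases "F q \<in> W")
        case True
        have "differential B F (X q) \<in> tangent_space B (F q)"
          using X(1) sub by (auto simp: smooth_vfield_def)
        from rep[OF True this, of f] have "differential B F (X q) f = 0"
          using X(3) by (simp add: dh[symmetric])
        then show ?thesis by (auto simp: differential_def split: if_splits)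
      qed (simp add: differential_def \<beta>(3))
      then show ?thesis
        using sX by (auto simp: vertical_def smooth_vfield_def fun_eq_iff)
    qed
  qed (rule sX)
qed

section \<open>Sasakian manifolds\<close>

lemma tangent_space_plus: "u \<in> tangent_space A p \<Longrightarrow> v \<in> tangent_space A p \<Longrightarrow> u + v \<in> tangent_space A p"
  using tangent_space_lincomb[of u A p v 1 1] by (simp add: plus_fun_def)

lemma tangent_space_scale_fun: "u \<in> tangent_space A p \<Longrightarrow> a *\<^sub>f u \<in> tangent_space A p"
  using tangent_space_lincomb[of u A p u a 0] by (simp add: scale_fun_def)

lemma diff_eq_plus_scale_fun: "u - v = u + (- 1) *\<^sub>f v"
  by (simp add: fun_eq_iff scale_fun_def)

lemma tangent_space_diff: "u \<in> tangent_space A p \<Longrightarrow> v \<in> tangent_space A p \<Longrightarrow> u - v \<in> tangent_space A p"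
  by (simp add: diff_eq_plus_scale_fun tangent_space_plus tangent_space_scale_fun)

lemma metric_sym:
  "riemannian_metric A g \<Longrightarrow> u \<in> tangent_space A p \<Longrightarrow> v \<in> tangent_space A p \<Longrightarrow> g p u v = g p v u"
  unfolding riemannian_metric_def by blast

lemma metric_scale:
  "riemannian_metric A g \<Longrightarrow> u \<in> tangent_space A p \<Longrightarrow> w \<in> tangent_space A p \<Longrightarrow>
    g p (a *\<^sub>f u) w = a * g p u w"
  unfolding riemannian_metric_def by blast

lemma metric_diff:
  assumes "riemannian_metric A g" "u \<in> tangent_space A p" "v \<in> tangent_space A p" "w \<in> tangent_space A p"
  shows "g p (u - v) w = g p u w - g p v w"
proof -
  have "g p (u + (- 1) *\<^sub>f v) w = g p u w + g p ((- 1) *\<^sub>f v) w"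
    using assms tangent_space_scale_fun[OF assms(3)] unfolding riemannian_metric_def by blast
  then show ?thesis
    by (simp add: diff_eq_plus_scale_fun metric_scale[OF assms(1,3,4)])
qed

lemma metric_zero:
  assumes "riemannian_metric A g" "w \<in> tangent_space A p"
  shows "g p 0 w = 0"
  using metric_diff[OF assms(1,2,2,2)] by simp

lemma vertical_subset: "vertical A B F p \<subseteq> tangent_space A p"
  by (auto simp: vertical_def)

text \<open>The definite description demands uniqueness: a candidate \<open>v\<close> tested against
  itself gives \<open>g p v v = 0\<close>, hence \<open>v = 0\<close> by positivity.\<close>

lemma orth_proj_eq_0:
  assumes g: "riemannian_metric A g" and V: "V \<subseteq> tangent_space A p" "0 \<in> V"
    and w: "w \<in> tangent_space A p" "\<And>v. v \<in> V \<Longrightarrow> g p w v = 0"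
  shows "orth_proj (g p) V w = 0"
  unfolding orth_proj_def
proof (rule the_equality)
  fix v assume v: "v \<in> V \<and> (\<forall>u\<in>V. g p (w - v) u = 0)"
  then have vt: "v \<in> tangent_space A p" using V by blast
  have "g p v v = 0"
    using v metric_diff[OF g w(1) vt vt] w(2)[of v] by auto
  then show "v = 0"
    using g vt unfolding riemannian_metric_def by (metis less_irrefl)
qed (use V w in auto)

lemma smooth_vfield_tangent: "smooth_vfield A X \<Longrightarrow> X p \<in> tangent_space A p"
  by (simp add: smooth_vfield_def)

text \<open>Vertical fields send each pullback \<open>f \<circ> F\<close> to the zero function, so
  both iterated derivatives in the bracket vanish. Tangency of the bracket is a premise because
  torsion-freeness of the connection will supply it.\<close>

lemma lie_bracket_vertical:
  assumes X: "\<And>q. X q \<in> vertical A B F q" and Y: "\<And>q. Y q \<in> vertical A B F q"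
    and t: "lie_bracket X Y p \<in> tangent_space A p"
  shows "lie_bracket X Y p \<in> vertical A B F p"
proof -
  have "Z q (f \<circ> F) = 0" if "\<And>q. Z q \<in> vertical A B F q" "smooth_fun B f" for Z q f
  proof -
    have "differential B F (Z q) f = 0" using that(1)[of q] by (simp add: vertical_def)
    then show ?thesis using that(2) by (simp add: differential_def)
  qed
  note 0 = this[OF X] this[OF Y]
  have "X p \<in> tangent_space A p" "Y p \<in> tangent_space A p"
    using X Y vertical_subset by blast+
  then have "differential B F (lie_bracket X Y p) = 0"
    using tangent_const[of "X p" A p 0] tangent_const[of "Y p" A p 0]
    by (auto simp: fun_eq_iff differential_def lie_bracket_def apply_vfield_def 0)
  then show ?thesis using t by (simp add: vertical_def)
qed

lemma affine_connection_zero: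
  assumes "affine_connection A D" "smooth_vfield A X"
  shows "D X 0 = 0"
proof -
  have "smooth_vfield A 0" using smooth_vfield_zero[of A] by (simp add: zero_fun_def)
  then have "D X (0 + 0) = D X 0 + D X 0"
    using assms unfolding affine_connection_def by blast
  then show ?thesis by simp
qed

lemma vertical_phi_orthogonal:
  fixes A :: "('m::{t2_space, second_countable_topology}, 'e::euclidean_space) chart set"
    and B :: "('n::{t2_space, second_countable_topology}, 'k::euclidean_space) chart set"
  assumes S: "sasakian_manifold A \<phi> \<xi> \<eta> g" and B: "smooth_manifold B" and F: "smooth_map A B F"
    and sub: "\<And>q. differential B F ` tangent_space A q = tangent_space B (F q)"
    and \<xi>: "\<And>q v. v \<in> vertical A B F q \<Longrightarrow> g q (\<xi> q) v = 0"
    and u: "u \<in> vertical A B F p" and v: "v \<in> vertical A B F p"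
  shows "g p (\<phi> p u) v = 0"
proof -
  let ?T = "tangent_space A"
  have A: "smooth_manifold A" and ac: "almost_contact_metric A \<phi> \<xi> \<eta> g"
    using S by (auto simp: sasakian_manifold_def)
  obtain D where D: "levi_civita A g D" and sas: "\<And>X Y p. smooth_vfield A X \<Longrightarrow> smooth_vfield A Y \<Longrightarrow>
      D X (\<lambda>q. \<phi> q (Y q)) p - \<phi> p (D X Y p) = g p (X p) (Y p) *\<^sub>f \<xi> p - \<eta> p (Y p) *\<^sub>f X p"
    using S unfolding sasakian_manifold_def by blast
  have conn: "affine_connection A D"
    using D by (simp add: levi_civita_def)
  have D_smooth: "smooth_vfield A (D X Y)" if "smooth_vfield A X" "smooth_vfield A Y" for X Y
    using conn that unfolding affine_connection_def by blast
  have g: "riemannian_metric A g" and \<xi>s: "smooth_vfield A \<xi>"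
    using ac by (auto simp: almost_contact_metric_def)
  have \<phi>T: "\<phi> q w \<in> ?T q" if "w \<in> ?T q" for q w
    using ac that unfolding almost_contact_metric_def tensor11_def by blast
  have \<phi>\<xi>: "\<phi> q (\<xi> q) = 0" and \<eta>\<xi>: "\<eta> q (\<xi> q) = 1" for q
    using ac by (auto simp: almost_contact_metric_def)
  have \<phi>\<phi>: "\<phi> q (\<phi> q w) = \<eta> q w *\<^sub>f \<xi> q - w" and \<eta>\<phi>: "\<eta> q (\<phi> q w) = 0"
    and \<eta>: "\<eta> q w = g q w (\<xi> q)" if "w \<in> ?T q" for q w
    using ac that by (auto simp: almost_contact_metric_def)
  have g\<phi>: "g q (\<phi> q w) (\<phi> q z) = g q w z - \<eta> q w * \<eta> q z" if "w \<in> ?T q" "z \<in> ?T q" for q w z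
    using ac that by (auto simp: almost_contact_metric_def)
  note \<xi>T = smooth_vfield_tangent[OF \<xi>s]
  have \<xi>\<phi>: "g q (\<xi> q) (\<phi> q w) = 0" if "w \<in> ?T q" for q w
    using \<eta>[OF \<phi>T[OF that]] \<eta>\<phi>[OF that] metric_sym[OF g \<xi>T \<phi>T[OF that]] by simp

  have vert\<eta>: "\<eta> q w = 0" if "w \<in> vertical A B F q" for q w
    using \<eta>[of w q] \<xi>[OF that] that vertical_subset[of A B F q] metric_sym[OF g \<xi>T, of w q] by auto
  have skew: "g q (\<phi> q w) z = - g q w (\<phi> q z)" if w: "w \<in> ?T q" and z: "z \<in> ?T q" for q w z
  proof -
    \<comment> \<open>Compatibility of the metric is applied to \<open>\<phi> q w\<close> and
      \<open>z\<close>; its correction term drops out because \<eta> vanishes on the image of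
      \<phi>.\<close>
    have "g q (\<phi> q w) z = g q (\<eta> q w *\<^sub>f \<xi> q - w) (\<phi> q z)"
      using g\<phi>[OF \<phi>T[OF w] z] by (simp add: \<phi>\<phi> \<eta>\<phi> w)
    also have "\<dots> = - g q w (\<phi> q z)"
      using metric_diff[OF g tangent_space_scale_fun[OF \<xi>T] w \<phi>T[OF z]]
      by (simp add: metric_scale[OF g \<xi>T \<phi>T[OF z]] \<xi>\<phi>[OF z])
    finally show ?thesis .
  qed
  text \<open>This is \<open>D\<^sub>X \<xi> = - \<phi> X\<close>, tested against vectors orthogonal to \<open>\<xi>\<close>.\<close>
  have D\<xi>: "g q (D X \<xi> q) z = g q (X q) (\<phi> q z)"
    if X: "smooth_vfield A X" and z: "z \<in> ?T q" "\<eta> q z = 0" for X q z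
  proof -
    note XT = smooth_vfield_tangent[OF X, of q]
    have DT: "D X \<xi> q \<in> ?T q" by (intro smooth_vfield_tangent D_smooth X \<xi>s)
    \<comment> \<open>With \<open>Y = \<xi>\<close> the first term of the Sasakian identity is the
      derivative of the zero field.\<close>
    have "D X (\<lambda>q. \<phi> q (\<xi> q)) = 0"
      using affine_connection_zero[OF conn X] by (simp add: \<phi>\<xi> zero_fun_def)
    then have "- \<phi> q (D X \<xi> q) = \<eta> q (X q) *\<^sub>f \<xi> q - X q"
      using sas[OF X \<xi>s, of q] by (simp add: \<eta>\<xi> \<eta>[OF XT] scale_fun_def)
    then have "\<phi> q (D X \<xi> q) = X q - \<eta> q (X q) *\<^sub>f \<xi> q"
      by (metis minus_diff_eq minus_minus)
    \<comment> \<open>Pairing with \<open>\<phi> q z\<close> kills the \<xi> component on the right;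
      on the left compatibility then removes both copies of \<phi>, since
      \<open>\<eta> q z = 0\<close>.\<close>
    then have "g q (\<phi> q (D X \<xi> q)) (\<phi> q z) = g q (X q) (\<phi> q z)"
      using metric_diff[OF g XT tangent_space_scale_fun[OF \<xi>T] \<phi>T[OF z(1)]]
      by (simp add: metric_scale[OF g \<xi>T \<phi>T[OF z(1)]] \<xi>\<phi>[OF z(1)])
    then show ?thesis using g\<phi>[OF DT z(1)] z(2) by simp
  qed

  obtain X where X: "smooth_vfield A X" "X p = u" "\<And>q. X q \<in> vertical A B F q"
    using vertical_vfield_extends[OF A B F sub u] by blast
  obtain Y where Y: "smooth_vfield A Y" "Y p = v" "\<And>q. Y q \<in> vertical A B F q"
    using vertical_vfield_extends[OF A B F sub v] by blast
  have der: "g p (D X Y p) (\<xi> p) = - g p (X p) (\<phi> p (Y p))"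
    if X: "smooth_vfield A X" "\<And>q. X q \<in> vertical A B F q"
      and Y: "smooth_vfield A Y" "\<And>q. Y q \<in> vertical A B F q" for X Y
  proof -
    note YT = smooth_vfield_tangent[OF Y(1)]
    have "X p (\<lambda>q. g q (Y q) (\<xi> q)) = g p (D X Y p) (\<xi> p) + g p (Y p) (D X \<xi> p)"
      using D X(1) Y(1) \<xi>s unfolding levi_civita_def by blast
    moreover have "X p (\<lambda>q. g q (Y q) (\<xi> q)) = 0"
      using vert\<eta>[OF Y(2)] tangent_const[OF smooth_vfield_tangent[OF X(1)]]
      by (simp add: \<eta>[OF YT, symmetric])
    moreover have "g p (Y p) (D X \<xi> p) = g p (X p) (\<phi> p (Y p))"
      using D\<xi>[OF X(1) YT vert\<eta>[OF Y(2)]]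
        metric_sym[OF g YT smooth_vfield_tangent[OF D_smooth[OF X(1) \<xi>s]]] by simp
    ultimately show ?thesis by simp
  qed
  note XY = smooth_vfield_tangent[OF D_smooth[OF X(1) Y(1)], of p]
    and YX = smooth_vfield_tangent[OF D_smooth[OF Y(1) X(1)], of p]
  have "D X Y - D Y X = lie_bracket X Y"
    using D X(1) Y(1) unfolding levi_civita_def by blast
  then have br: "D X Y p - D Y X p = lie_bracket X Y p"
    by (simp add: fun_eq_iff)
  \<comment> \<open>Torsion-freeness writes the bracket as a difference of two covariant
    derivatives, which shows that it is tangent.\<close>
  then have "lie_bracket X Y p \<in> vertical A B F p"
    using tangent_space_diff[OF XY YX] by (intro lie_bracket_vertical X(3) Y(3)) simp
  then have "g p (D X Y p - D Y X p) (\<xi> p) = 0"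
    using vert\<eta> \<eta>[OF tangent_space_diff[OF XY YX]] by (simp add: br)
  then have "g p (Y p) (\<phi> p (X p)) = g p (X p) (\<phi> p (Y p))"
    using metric_diff[OF g XY YX \<xi>T] der[OF X(1,3) Y(1,3)] der[OF Y(1,3) X(1,3)] by simp
  \<comment> \<open>The bilinear form \<open>g p (\<phi> p u) v\<close> is now symmetric in the pair
    \<open>u\<close>, \<open>v\<close> and, by \<open>skew\<close>, also antisymmetric; hence it is
    0.\<close>
  moreover have "u \<in> ?T p" "v \<in> ?T p" using u v vertical_subset by blast+
  ultimately show ?thesis
    using skew[of u p v] metric_sym[OF g _ \<phi>T, of v p u] X(2) Y(2) by simp
qed

theorem theorem1:
  fixes A :: "('m::{t2_space, second_countable_topology}, 'e::euclidean_space) chart set"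
    and B :: "('n::{t2_space, second_countable_topology}, 'k::euclidean_space) chart set"
    and \<phi> :: "'m \<Rightarrow> 'm tvec \<Rightarrow> 'm tvec"
    and \<xi> :: "'m vfield"
    and \<eta> :: "'m \<Rightarrow> 'm tvec \<Rightarrow> real"
    and g\<^sub>M :: "'m \<Rightarrow> 'm tvec \<Rightarrow> 'm tvec \<Rightarrow> real"
    and g\<^sub>N :: "'n \<Rightarrow> 'n tvec \<Rightarrow> 'n tvec \<Rightarrow> real"
    and F :: "'m \<Rightarrow> 'n"
  assumes "sasakian_manifold A \<phi> \<xi> \<eta> g\<^sub>M"
    and "riemannian_manifold B g\<^sub>N"
    and "slant_submersion A \<phi> \<xi> g\<^sub>M B g\<^sub>N F"
    and "\<forall>p. \<forall>v\<in>vertical A B F p. g\<^sub>M p (\<xi> p) v = 0"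
  shows "anti_invariant_submersion A \<phi> \<xi> g\<^sub>M B g\<^sub>N F"
proof -
  have B: "smooth_manifold B" using assms(2) by (simp add: riemannian_manifold_def)
  have rs: "riemannian_submersion A g\<^sub>M B g\<^sub>N F"
    using assms(3) by (auto simp: slant_submersion_def slant_submersion_with_angle_def)
  then have F: "smooth_map A B F"
    and sub: "\<And>q. differential B F ` tangent_space A q = tangent_space B (F q)"
    by (simp_all add: riemannian_submersion_def)
  have g: "riemannian_metric A g\<^sub>M" and \<phi>: "tensor11 A \<phi>"
    using assms(1) by (auto simp: sasakian_manifold_def almost_contact_metric_def)
  have "angle_to_subspace (g\<^sub>M p) (\<phi> p u) (vertical A B F p) = pi / 2"
    if u: "u \<in> vertical A B F p" for p u
  proof -
    have 0: "(0 :: 'm tvec) \<in> vertical A B F p"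
      using tangent_space_zero[of A p] by (simp add: vertical_def differential_def zero_fun_def)
    have "\<phi> p u \<in> tangent_space A p"
      using \<phi> u vertical_subset unfolding tensor11_def by blast
    moreover have "g\<^sub>M p (\<phi> p u) v = 0" if "v \<in> vertical A B F p" for v
      using vertical_phi_orthogonal[OF assms(1) B F sub _ u that] assms(4) by blast
    ultimately have "orth_proj (g\<^sub>M p) (vertical A B F p) (\<phi> p u) = 0"
      by (intro orth_proj_eq_0[OF g vertical_subset 0])
    \<comment> \<open>The numerator in the angle is \<open>sqrt 0\<close>, so the quotient is 0 for
      any denominator (a zero one included), and the angle is \<open>arccos 0\<close>.\<close>
    then show ?thesis
      using metric_zero[OF g, of 0 p] 0 by (simp add: angle_to_subspace_def vertical_def)
  qed
  then show ?thesis
    using rs by (simp add: anti_invariant_submersion_def slant_submersion_with_angle_def)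
qed

end
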